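(* Let $p=4k+1$ be a prime. For a graph $\Gamma$ on four vertices let $n_p(\Gamma)$ be as defined in the context, and put $$J(k)=\sum_{i=1}^{4k-2}\Big(\frac{i(i+1)(i+2)}{p}\Big),\qquad d(k)=\frac{J(k)^2-4}{32}.$$ Then for each of the $11$ isomorphism classes of simple graphs $\Gamma$ on four vertices there is a polynomial $P_\Gamma\in\mathbb{Q}[u,v]$, independent of $p$, such that $n_p(\Gamma)=P_\Gamma(k,d(k))$ for all primes $p=4k+1$. In particular, for the complete graph $K_4$, $$n_p(K_4)=\frac{k(k-1)(k-4)+2k\,d(k)}{24}.$$
   Context: $\big(\frac{a}{p}\big)$ is the Legendre symbol. For $p\equiv 1\pmod 4$ and an $\ell$-tuple $A=(r_1,\ldots,r_\ell)$ of pairwise distinct residues modulo $p$, let $\Gamma_A$ be the graph on vertices $v_1,\ldots,v_\ell$ with $v_i,v_j$ joined by an edge iff $r_i-r_j$ is a nonzero quadratic residue mod $p$ (symmetric since $-1$ is a square). Two tuples are identified if they differ by a permutation of entries or by adding the same residue $a$ to all entries. For a graph $\Gamma$ on $\ell$ vertices, $n_p(\Gamma)$ is the number of such classes of tuples $A$ with $\Gamma_A$ isomorphic to $\Gamma$. *)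

theory Defs
  imports "HOL-Number_Theory.Number_Theory"
begin

definition qr_adj :: "int \<Rightarrow> int \<Rightarrow> int \<Rightarrow> bool" where
  "qr_adj p x y \<longleftrightarrow> Legendre (x - y) p = 1"

definition graph_iso :: "'a set \<Rightarrow> ('a \<Rightarrow> 'a \<Rightarrow> bool) \<Rightarrow> 'b set \<Rightarrow> ('b \<Rightarrow> 'b \<Rightarrow> bool) \<Rightarrow> bool" where
  "graph_iso V1 E1 V2 E2 \<longleftrightarrow>
     (\<exists>f. bij_betw f V1 V2 \<and> (\<forall>x\<in>V1. \<forall>y\<in>V1. E1 x y \<longleftrightarrow> E2 (f x) (f y)))"

definition shift_res :: "int \<Rightarrow> int \<Rightarrow> int set \<Rightarrow> int set" where
  "shift_res p a S = (\<lambda>x. (x + a) mod p) ` S"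

text \<open>Sets of residues (tuples of pairwise distinct residues up to permutation)
  whose quadratic-residue graph is isomorphic to (V,E).\<close>
definition good_sets :: "nat \<Rightarrow> nat set \<Rightarrow> (nat \<Rightarrow> nat \<Rightarrow> bool) \<Rightarrow> int set set" where
  "good_sets p V E = {S. S \<subseteq> {0..<int p} \<and> card S = card V \<and>
                        graph_iso S (qr_adj (int p)) V E}"

definition n_p :: "nat \<Rightarrow> nat set \<Rightarrow> (nat \<Rightarrow> nat \<Rightarrow> bool) \<Rightarrow> nat" where
  "n_p p V E = card {C. \<exists>S\<in>good_sets p V E.
                  C = {T. \<exists>a\<in>{0..<int p}. T = shift_res (int p) a S}}"

definition J :: "nat \<Rightarrow> int" where
  "J k = (\<Sum>i = 1..int (4*k) - 2. Legendre (i * (i+1) * (i+2)) (int (4*k+1)))"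

definition d :: "nat \<Rightarrow> rat" where
  "d k = (of_int (J k)^2 - 4) / 32"

definition simple_graph4 :: "(nat \<Rightarrow> nat \<Rightarrow> bool) \<Rightarrow> bool" where
  "simple_graph4 E \<longleftrightarrow> (\<forall>x\<in>{0..<4}. \<forall>y\<in>{0..<4}. (E x y \<longleftrightarrow> E y x) \<and> \<not> E x x)"

end

theory Submission
  imports Defs
begin

text \<open>
  Let \<open>\<chi>\<close> be the quadratic character modulo \<open>p\<close>. The number of labelled embeddings of a graph is a sum
  over quadruples of the product of \<open>(\<chi>\<^sup>2 \<plusminus> \<chi>) / 2\<close> over the six edges. Expanding the product, every monomial
  whose edge set is not all of \<open>K\<^sub>4\<close> can be summed vertex by vertex and gives a polynomial in \<open>p\<close>. The
  remaining one is \<open>p (p - 1) \<Sigma>\<^sub>c \<chi>(c (1 - c)) H(c)\<close>, where \<open>H(l) = \<Sigma>\<^sub>x \<chi>(x (x - 1) (x - l))\<close>.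
  Substituting \<open>x = w y\<close> in \<open>J\<^sup>2 = \<Sigma> \<chi>(x (x\<^sup>2 - 1) y (y\<^sup>2 - 1))\<close> gives \<open>J\<^sup>2 = 2 p + \<Sigma>\<^sub>w \<chi>(w) H(w\<^sup>2)\<close>.
  The 2-isogeny of the Legendre curve shows \<open>H(w\<^sup>2) = H(v\<^sup>2)\<close> for \<open>v = (1 - w) / (1 + w)\<close>, and then
  \<open>\<chi>(w) = \<chi>(1 - v\<^sup>2)\<close>, so that \<open>c = v\<^sup>2\<close> turns this sum into the sum for \<open>K\<^sub>4\<close>.
  Finally, every good set comes from as many embeddings as the graph has automorphisms, and translations
  act freely on good sets because \<open>p\<close> does not divide \<open>4\<close>.
\<close>

subsection \<open>The quadratic character modulo a prime congruent to 1 mod 4\<close>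

locale prime_1_mod_4 =
  fixes p :: int
  assumes prime_p: "prime p" and p_mod_4: "p mod 4 = 1"
begin

definition chi :: "int \<Rightarrow> int" where "chi x = Legendre x p"

abbreviation R :: "int set" where "R \<equiv> {0..<p}"

text \<open>Indicators stay as integer factors below; these rules would turn such sums into
  cardinalities or restricted sums.\<close>

declare sum_of_bool_eq [simp del] sum_of_bool_mult_eq [simp del] sum_mult_of_bool_eq [simp del]

lemma p_gt_4: "p > 4"
proof -
  have "p > 1" using prime_p prime_gt_1_int by auto
  then show ?thesis using p_mod_4 by presburger
qed

lemma not_dvd_2: "\<not> p dvd 2" and not_dvd_4: "\<not> p dvd 4"
  using p_gt_4 by (auto dest: zdvd_imp_le)

lemma dvd_mult_iff: "p dvd x * y \<longleftrightarrow> p dvd x \<or> p dvd y"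
  using prime_p prime_dvd_mult_iff by auto

lemma chi_cong: "[x = y] (mod p) \<Longrightarrow> chi x = chi y"
  by (simp add: chi_def Legendre_def QuadRes_def cong_def)

lemma chi_mod [simp]: "chi (x mod p) = chi x"
  by (rule chi_cong) simp

lemma chi_eq_0_iff: "chi x = 0 \<longleftrightarrow> p dvd x"
  unfolding chi_def Legendre_def by (simp add: cong_0_iff)

lemma chi_0 [simp]: "chi 0 = 0"
  by (simp add: chi_eq_0_iff)

lemma chi_cases: "chi x = -1 \<or> chi x = 0 \<or> chi x = 1"
  unfolding chi_def Legendre_def by simp

lemma euler: "[chi x = x ^ nat ((p - 1) div 2)] (mod p)"
proof -
  have "[Legendre x (int (nat p)) = x ^ ((nat p - 1) div 2)] (mod int (nat p))"
    using prime_p p_gt_4 by (intro euler_criterion) auto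
  moreover have "(nat p - 1) div 2 = nat ((p - 1) div 2)"
    using p_gt_4 by (simp add: nat_div_distrib nat_diff_distrib)
  ultimately show ?thesis using p_gt_4 by (simp add: chi_def)
qed

text \<open>Upgrades the congruence in Euler's criterion to an equality: two such numbers differ by
  at most 2, which is less than \<open>p\<close>.\<close>

lemma small_cong_eq:
  assumes "[x = y] (mod p)" "\<bar>x\<bar> \<le> 1" "\<bar>y\<bar> \<le> 1"
  shows "x = y"
proof -
  have "p dvd x - y" using assms(1) by (simp add: cong_iff_dvd_diff)
  moreover have "\<bar>x - y\<bar> < p" using assms p_gt_4 by linarith
  ultimately show ?thesis using dvd_imp_le_int[of "x - y" p] p_gt_4 by force
qed

lemma chi_mult: "chi (x * y) = chi x * chi y"
proof (rule small_cong_eq)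
  let ?n = "nat ((p - 1) div 2)"
  have "[chi x * chi y = x ^ ?n * y ^ ?n] (mod p)" by (intro cong_mult euler)
  then show "[chi (x * y) = chi x * chi y] (mod p)"
    using euler[of "x * y"] by (metis cong_sym cong_trans power_mult_distrib)
qed (use chi_cases[of "x * y"] chi_cases[of x] chi_cases[of y] in auto)

lemma chi_square_eq: "chi x * chi x = of_bool (\<not> p dvd x)"
  using chi_cases[of x] chi_eq_0_iff[of x] by auto

lemma chi_square: "\<not> p dvd x \<Longrightarrow> chi x * chi x = 1"
  by (simp add: chi_square_eq)

lemma chi_1 [simp]: "chi 1 = 1"
proof -
  have "QuadRes p 1" unfolding QuadRes_def by (rule exI[of _ 1]) simp
  moreover have "\<not> [1 = 0] (mod p)" using p_gt_4 by (simp add: cong_0_iff)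
  ultimately show ?thesis by (simp add: chi_def Legendre_def)
qed

lemma chi_minus_1: "chi (-1) = 1"
proof (rule small_cong_eq)
  \<comment> \<open>Here \<open>p mod 4 = 1\<close> makes -1 a square, which later makes adjacency
    symmetric.\<close>
  have "even ((p - 1) div 2)" using p_mod_4 by presburger
  then have "even (nat ((p - 1) div 2))" using p_gt_4 by (simp add: even_nat_iff)
  then have "(- 1 :: int) ^ nat ((p - 1) div 2) = 1" by simp
  then show "[chi (-1) = 1] (mod p)" using euler[of "-1"] by simp
qed (use chi_cases[of "-1"] in auto)

lemma chi_minus: "chi (- x) = chi x"
  using chi_mult[of "-1" x] chi_minus_1 by simp

lemma chi_diff_commute: "chi (x - y) = chi (y - x)"
  using chi_minus[of "y - x"] by simp

section \<open>Sums over a complete residue system\<close>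

lemma sum_affine:
  fixes f :: "int \<Rightarrow> int"
  assumes f: "\<And>x. f (x mod p) = f x" and a: "\<not> p dvd a"
  shows "(\<Sum>x\<in>R. f (a * x + b)) = (\<Sum>x\<in>R. f x)"
proof -
  let ?g = "\<lambda>x. (a * x + b) mod p"
  \<comment> \<open>Being injective on the finite set \<open>R\<close>, the affine map permutes it;
    \<open>f\<close> only sees residue classes.\<close>
  have "inj_on ?g R"
  proof (rule inj_onI)
    fix x y assume xy: "x \<in> R" "y \<in> R" "?g x = ?g y"
    then have "p dvd a * (x - y)" by (simp add: mod_eq_dvd_iff algebra_simps)
    then have "p dvd x - y" using a by (simp add: dvd_mult_iff)
    then show "x = y" using xy by (metis atLeastLessThan_iff mod_eq_dvd_iff mod_pos_pos_trivial)
  qed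
  moreover have "?g ` R \<subseteq> R" using p_gt_4 by auto
  ultimately have "bij_betw ?g R R"
    by (simp add: bij_betw_def endo_inj_surj)
  then have "(\<Sum>x\<in>R. f (?g x)) = (\<Sum>x\<in>R. f x)"
    by (rule sum.reindex_bij_betw)
  then show ?thesis by (simp add: f)
qed

lemma sum_scale:
  fixes f :: "int \<Rightarrow> int"
  assumes "\<And>x. f (x mod p) = f x" "\<not> p dvd a"
  shows "(\<Sum>x\<in>R. f (a * x)) = (\<Sum>x\<in>R. f x)"
  using sum_affine[of f a 0, OF assms] by simp

lemma sum_shift:
  fixes f :: "int \<Rightarrow> int"
  assumes "\<And>x. f (x mod p) = f x"
  shows "(\<Sum>x\<in>R. f (x + b)) = (\<Sum>x\<in>R. f x)"
  using sum_affine[of f 1 b, OF assms] p_gt_4 by simp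

lemma dvd_R_iff: "x \<in> R \<Longrightarrow> p dvd x \<longleftrightarrow> x = 0"
  using zdvd_imp_le[of p x] by force

lemma dvd_diff_R_iff: "x \<in> R \<Longrightarrow> y \<in> R \<Longrightarrow> p dvd x - y \<longleftrightarrow> x = y"
  by (simp add: mod_eq_dvd_iff[symmetric])

text \<open>The indicator uses divisibility instead of equality, so that \<open>a\<close> may be any
  integer, not only a representative in \<open>R\<close>.\<close>

lemma sum_delta_R:
  fixes f :: "int \<Rightarrow> int"
  assumes "\<And>x. f (x mod p) = f x"
  shows "(\<Sum>x\<in>R. of_bool (p dvd x - a) * f x) = f a"
proof -
  have eq: "p dvd x - a \<longleftrightarrow> x = a mod p" if "x \<in> R" for x
    using that by (metis atLeastLessThan_iff mod_eq_dvd_iff mod_mod_trivial mod_pos_pos_trivial)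
  have "(\<Sum>x\<in>R. of_bool (p dvd x - a) * f x) = (\<Sum>x\<in>R. if x = a mod p then f x else 0)"
    using eq by (intro sum.cong) auto
  also have "\<dots> = f a" using p_gt_4 assms by (simp add: sum.delta)
  finally show ?thesis .
qed

text \<open>Given one root \<open>y\<close>, the difference of squares factors as (x - y)(x + y).
  Since \<open>p\<close> is odd, the two roots coincide only if \<open>p\<close> divides
  \<open>y\<close>, and then \<open>chi z\<close> is 0.\<close>

lemma card_square_roots: "(\<Sum>x\<in>R. of_bool (p dvd x * x - z)) = 1 + chi z"
proof (cases "\<exists>y. p dvd y * y - z")
  case False
  then have "\<not> QuadRes p z" "\<not> p dvd z"
    unfolding QuadRes_def by (auto simp: cong_iff_dvd_diff power2_eq_square dest: spec[of _ 0])
  with False show ?thesis by (simp add: chi_def Legendre_def cong_0_iff)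
next
  case True
  then obtain y where y: "p dvd y * y - z" by blast
  then have cong: "[y * y = z] (mod p)" by (simp add: cong_iff_dvd_diff)
  have root: "p dvd x * x - z \<longleftrightarrow> p dvd x - y \<or> p dvd x - (- y)" for x
  proof -
    have "p dvd x * x - z \<longleftrightarrow> p dvd (x * x - z) - (y * y - z)"
      using y by (metis dvd_diff_left_iff)
    also have "(x * x - z) - (y * y - z) = (x - y) * (x - (- y))" by (simp add: algebra_simps)
    finally show ?thesis by (simp add: dvd_mult_iff)
  qed
  have one: "(\<Sum>x\<in>R. of_bool (p dvd x - a)) = (1::int)" for a
    using sum_delta_R[of "\<lambda>_. 1" a] by simp
  show ?thesis
  proof (cases "p dvd y")
    case True
    then have "p dvd x * x - z \<longleftrightarrow> p dvd x - 0" for x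
      using root[of x] dvd_diff_left_iff[OF True] dvd_add_left_iff[OF True] by simp
    then have "(\<Sum>x\<in>R. of_bool (p dvd x * x - z)) = (1::int)"
      using one[of 0] by simp
    moreover have "chi z = 0" using True chi_cong[OF cong] chi_mult[of y y] chi_eq_0_iff[of y] by simp
    ultimately show ?thesis by simp
  next
    case False
    have "\<not> (p dvd x - y \<and> p dvd x - (- y))" for x
    proof
      assume "p dvd x - y \<and> p dvd x - (- y)"
      then have "p dvd (x - (- y)) - (x - y)" by (blast intro: dvd_diff)
      then have "p dvd 2 * y" by simp
      then show False using False not_dvd_2 by (simp add: dvd_mult_iff)
    qed
    then have "of_bool (p dvd x * x - z) = of_bool (p dvd x - y) + (of_bool (p dvd x - (- y)) :: int)" for x
      using root[of x] by auto
    then have "(\<Sum>x\<in>R. of_bool (p dvd x * x - z)) = (2::int)"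
      using one[of y] one[of "- y"] by (simp only: sum.distrib)
    moreover have "chi z = 1" using False chi_cong[OF cong] chi_mult[of y y] chi_square by simp
    ultimately show ?thesis by simp
  qed
qed

text \<open>Group the left sum by the value z = y * y, which has 1 + \<open>chi z\<close> square
  roots.\<close>

lemma sum_squares:
  fixes f :: "int \<Rightarrow> int"
  assumes f: "\<And>x. f (x mod p) = f x"
  shows "(\<Sum>y\<in>R. f (y * y)) = (\<Sum>z\<in>R. (1 + chi z) * f z)"
proof -
  have "(\<Sum>y\<in>R. f (y * y)) = (\<Sum>y\<in>R. \<Sum>z\<in>R. of_bool (p dvd z - y * y) * f z)"
    by (simp add: sum_delta_R f)
  also have "\<dots> = (\<Sum>z\<in>R. (\<Sum>y\<in>R. of_bool (p dvd y * y - z)) * f z)"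
    by (subst sum.swap) (simp add: sum_distrib_right dvd_diff_commute)
  finally show ?thesis by (simp only: card_square_roots)
qed

text \<open>For constant \<open>f\<close> both sides of \<open>sum_squares\<close> contain the
  summand \<open>p\<close>; the character sum is what remains.\<close>

lemma sum_chi: "(\<Sum>x\<in>R. chi x) = 0"
  using sum_squares[of "\<lambda>_. 1"] by (simp add: sum.distrib)

lemma sum_chi_diff: "(\<Sum>x\<in>R. chi (x - a)) = 0"
proof -
  have "chi (x mod p) = chi x" for x by simp
  from sum_shift[of chi "- a", OF this] show ?thesis by (simp add: sum_chi)
qed

section \<open>Inverses modulo p and the sum of two characters\<close>

definition inv_p :: "int \<Rightarrow> int" where "inv_p x = modular_inverse p x"

lemma inv_p: "\<not> p dvd x \<Longrightarrow> p dvd x * inv_p x - 1"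
  unfolding inv_p_def using cong_modular_inverse1[of x p] prime_p
  by (simp add: cong_iff_dvd_diff coprime_commute prime_imp_coprime)

lemma inv_p_in_R: "inv_p x \<in> R"
  unfolding inv_p_def using p_gt_4 modular_inverse_int_nonneg modular_inverse_int_less by simp

lemma not_dvd_inv_p: assumes "\<not> p dvd x" shows "\<not> p dvd inv_p x"
proof
  assume "p dvd inv_p x"
  then have "p dvd x * inv_p x - (x * inv_p x - 1)" using inv_p[OF assms] by (metis dvd_diff dvd_mult)
  then show False using p_gt_4 by simp
qed

lemma inv_p_inv_p: assumes "x \<in> R - {0}" shows "inv_p (inv_p x) = x"
proof -
  have x: "\<not> p dvd x" using assms dvd_R_iff by auto
  let ?i = "inv_p x" and ?j = "inv_p (inv_p x)"
  have "p dvd ?j * (x * ?i - 1) - x * (?i * ?j - 1)"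
    using inv_p[OF x] inv_p[OF not_dvd_inv_p[OF x]] by (meson dvd_diff dvd_mult)
  then have "p dvd x - ?j" by (simp add: algebra_simps)
  then show ?thesis using assms inv_p_in_R dvd_diff_R_iff by (metis DiffD1)
qed

lemma sum_inverse:
  fixes f :: "int \<Rightarrow> int"
  shows "(\<Sum>x\<in>R - {0}. f (inv_p x)) = (\<Sum>x\<in>R - {0}. f x)"
proof -
  have "inv_p x \<in> R - {0}" if "x \<in> R - {0}" for x
    using that not_dvd_inv_p[of x] inv_p_in_R[of x] dvd_R_iff by auto
  then show ?thesis
    by (intro sum.reindex_bij_witness[where i = inv_p and j = inv_p]) (auto simp: inv_p_inv_p)
qed

lemma sum_R_minus_0: 
  fixes f :: "int \<Rightarrow> int"
  shows "(\<Sum>x\<in>R. f x) = f 0 + (\<Sum>x\<in>R - {0}. f x)"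
  using p_gt_4 by (intro sum.remove) auto

lemma chi_mod_add: "chi (x mod p + y) = chi (x + y)" "chi (y + x mod p) = chi (y + x)"
  "chi (x mod p - y) = chi (x - y)" "chi (y - x mod p) = chi (y - x)"
  by (auto intro!: chi_cong simp: cong_def mod_simps)

text \<open>After a shift to a = 0, taking x out of x + c turns the product into \<open>chi\<close>
  of a linear expression in 1/x, and inversion permutes the nonzero residues.\<close>

lemma sum_chi_chi: "(\<Sum>x\<in>R. chi (x - a) * chi (x - b)) = (if p dvd a - b then p - 1 else -1)"
proof -
  define c where "c = a - b"
  have "(\<Sum>x\<in>R. chi (x - a) * chi (x - b)) = (\<Sum>x\<in>R. chi (x + a - a) * chi (x + a - b))"
    by (rule sum_shift[symmetric]) (simp add: chi_mod_add)
  also have "\<dots> = (\<Sum>x\<in>R. chi x * chi (x + c))" by (simp add: c_def add_diff_eq)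
  also have "\<dots> = (\<Sum>x\<in>R - {0}. chi x * chi (x + c))" by (subst sum_R_minus_0) simp
  also have "\<dots> = (\<Sum>x\<in>R - {0}. chi (c * inv_p x + 1))"
  proof (rule sum.cong)
    fix x assume "x \<in> R - {0}"
    then have x: "\<not> p dvd x" using dvd_R_iff by auto
    have "chi (x + c) = chi (x * (c * inv_p x + 1))"
    proof (rule chi_cong)
      have "x + c - x * (c * inv_p x + 1) = - c * (x * inv_p x - 1)" by (simp add: algebra_simps)
      then show "[x + c = x * (c * inv_p x + 1)] (mod p)"
        using inv_p[OF x] by (simp add: cong_iff_dvd_diff)
    qed
    then show "chi x * chi (x + c) = chi (c * inv_p x + 1)"
      using chi_square[OF x] by (simp add: chi_mult mult.assoc[symmetric])
  qed simp
  also have "\<dots> = (\<Sum>x\<in>R - {0}. chi (c * x + 1))" by (rule sum_inverse)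
  \<comment> \<open>The subtracted 1 is the missing term at x = 0.\<close>
  also have "\<dots> = (\<Sum>x\<in>R. chi (c * x + 1)) - 1" by (subst sum_R_minus_0) simp
  also have "(\<Sum>x\<in>R. chi (c * x + 1)) = (if p dvd c then p else 0)"
  proof (cases "p dvd c")
    case True
    then have "chi (c * x + 1) = 1" for x
      using chi_cong[of "c * x + 1" 1] by (simp add: cong_iff_dvd_diff)
    with True show ?thesis using p_gt_4 by simp
  next
    case False
    then show ?thesis using sum_affine[of chi c 1] sum_chi by simp
  qed
  finally show ?thesis by (simp add: c_def)
qed

subsection \<open>The character sum of the complete graph\<close>

text \<open>The Legendre curve y^2 = x (x - 1) (x - l) has p + \<open>H l\<close> affine points
  modulo \<open>p\<close>, so for l other than 0 and 1 this is minus its trace of Frobenius.\<close>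

definition H :: "int \<Rightarrow> int" where "H l = (\<Sum>x\<in>R. chi x * chi (x - 1) * chi (x - l))"

text \<open>With \<open>H\<close> expanded, each term is the product of \<open>chi\<close> over the
  six edges of the complete graph on 0, 1, c and x: affine maps have been used to fix two
  vertices.\<close>

definition K4_sum :: int where "K4_sum = (\<Sum>c\<in>R. chi c * chi (1 - c) * H c)"

definition J_sum :: int where "J_sum = (\<Sum>x\<in>R. chi x * chi (x * x - 1))"

lemma H_cong: "[x = y] (mod p) \<Longrightarrow> H x = H y"
  unfolding H_def by (intro sum.cong refl arg_cong2[where f = "(*)"] chi_cong cong_diff cong_refl)

lemma H_mod [simp]: "H (x mod p) = H x"
  by (rule H_cong) simp

lemma H_1: "H 1 = -1"
proof -
  have "H 1 = (\<Sum>x\<in>R. chi x - of_bool (p dvd x - 1) * chi x)"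
    unfolding H_def by (intro sum.cong) (auto simp: mult.assoc chi_square_eq)
  then show ?thesis by (simp add: sum_subtractf sum_chi sum_delta_R)
qed

text \<open>The substitution is \<open>s = x + b / x\<close>; the value \<open>s\<close> is attained for \<open>1 + \<chi>(s\<^sup>2 - 4 b)\<close> values \<open>x\<close>.\<close>

lemma sum_chi_isogeny:
  assumes b: "\<not> p dvd b"
  shows "(\<Sum>x\<in>R. chi x * chi (x * x + a * x + b)) = (\<Sum>s\<in>R. chi (s + a) * chi (s * s - 4 * b))"
proof -
  have "(\<Sum>x\<in>R. chi x * chi (x * x + a * x + b))
      = (\<Sum>x\<in>R. \<Sum>s\<in>R. of_bool (p dvd x * x - s * x + b) * chi (s + a))"
  proof (rule sum.cong)
    fix x assume xR: "x \<in> R"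
    show "chi x * chi (x * x + a * x + b)
        = (\<Sum>s\<in>R. of_bool (p dvd x * x - s * x + b) * chi (s + a))"
    proof (cases "x = 0")
      case True
      then show ?thesis using b by simp
    next
      case False
      then have x: "\<not> p dvd x" using xR dvd_R_iff by auto
      define r where "r = x + b * inv_p x"
      have "p dvd - b * (x * inv_p x - 1)" using inv_p[OF x] by (rule dvd_mult)
      then have r: "p dvd x * x - r * x + b" by (simp add: r_def algebra_simps)
      have iff: "p dvd x * x - s * x + b \<longleftrightarrow> p dvd s - r" for s
      proof -
        have "p dvd x * x - s * x + b \<longleftrightarrow> p dvd (x * x - r * x + b) - (x * x - s * x + b)"
          using r by (metis dvd_diff_right_iff)
        also have "(x * x - r * x + b) - (x * x - s * x + b) = (s - r) * x" by (simp add: algebra_simps)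
        finally show ?thesis using x by (simp add: dvd_mult_iff)
      qed
      \<comment> \<open>Modulo \<open>p\<close>, x * x + b is r * x, so the quadratic equals x (r +
        a).\<close>
      have "chi (x * x + a * x + b) = chi (x * (r + a))"
        using r by (intro chi_cong) (simp add: cong_iff_dvd_diff algebra_simps)
      then have "chi x * chi (x * x + a * x + b) = chi (r + a)"
        using chi_square[OF x] by (simp add: chi_mult mult.assoc[symmetric])
      then show ?thesis by (simp add: iff sum_delta_R chi_mod_add)
    qed
  qed simp
  also have "\<dots> = (\<Sum>s\<in>R. (\<Sum>x\<in>R. of_bool (p dvd x * x - s * x + b)) * chi (s + a))"
    by (subst sum.swap) (simp add: sum_distrib_right)
  also have "\<dots> = (\<Sum>s\<in>R. (1 + chi (s * s - 4 * b)) * chi (s + a))"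
  proof (intro sum.cong refl arg_cong2[where f = "(*)"])
    fix s
    \<comment> \<open>Completing the square: multiply by 4, which is invertible, and substitute y =
      2 x - s.\<close>
    have "(\<Sum>x\<in>R. of_bool (p dvd x * x - s * x + b))
        = (\<Sum>x\<in>R. of_bool (p dvd (2 * x + - s) * (2 * x + - s) - (s * s - 4 * b)) :: int)"
    proof (intro sum.cong refl arg_cong[where f = of_bool])
      fix x
      have "(2 * x + - s) * (2 * x + - s) - (s * s - 4 * b) = 4 * (x * x - s * x + b)"
        by (simp add: algebra_simps)
      then show "p dvd x * x - s * x + b \<longleftrightarrow> p dvd (2 * x + - s) * (2 * x + - s) - (s * s - 4 * b)"
        using not_dvd_4 by (simp only: dvd_mult_iff) simp
    qed
    also have "\<dots> = (\<Sum>y\<in>R. of_bool (p dvd y * y - (s * s - 4 * b)))"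
      by (rule sum_affine[of "\<lambda>y. of_bool (p dvd y * y - (s * s - 4 * b))"])
        (simp_all only: not_dvd_2 mod_eq_dvd_iff[symmetric] mod_mult_eq not_False_eq_True)
    finally show "(\<Sum>x\<in>R. of_bool (p dvd x * x - s * x + b)) = 1 + chi (s * s - 4 * b)"
      by (simp only: card_square_roots)
  qed
  also have "\<dots> = (\<Sum>s\<in>R. chi (s - (- a))) + (\<Sum>s\<in>R. chi (s + a) * chi (s * s - 4 * b))"
    by (simp add: sum.distrib[symmetric] algebra_simps)
  finally show ?thesis by (simp only: sum_chi_diff)
qed

text \<open>The hypothesis on \<open>v\<close> says v = (1 - w) / (1 + w). The isogenous cubic has
  roots 1 + w^2, 2 w and -2 w; an affine change of variable whose scale is, up to sign, the square
  \<open>A\<close> brings it back to Legendre form.\<close>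

lemma H_isogeny:
  assumes w: "\<not> p dvd w" "\<not> p dvd 1 + w" and v: "p dvd v * (1 + w) - (1 - w)"
  shows "H (w * w) = H (v * v)"
proof -
  define A where "A = (1 + w) * (1 + w)"
  have A: "\<not> p dvd A" using w by (simp add: A_def dvd_mult_iff)
  have chiA: "chi A = 1" using w chi_square by (simp add: A_def chi_mult)
  have "p dvd (v * (1 + w) + (1 - w)) * (v * (1 + w) - (1 - w))" using v by (rule dvd_mult)
  then have B: "p dvd v * v * A - (1 - w) * (1 - w)" by (simp add: A_def algebra_simps)
  have "H (w * w) = (\<Sum>x\<in>R. chi x * chi (x * x + (- (1 + w * w)) * x + w * w))"
    unfolding H_def
    by (intro sum.cong refl) (simp add: mult.assoc chi_mult[symmetric] algebra_simps)
  also have "\<dots> = (\<Sum>s\<in>R. chi (s + - (1 + w * w)) * chi (s * s - 4 * (w * w)))"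
    using w by (intro sum_chi_isogeny) (simp add: dvd_mult_iff)
  \<comment> \<open>The substitution s = 1 + w^2 - A t takes the roots 1 + w^2, -2 w, 2 w to t = 0,
    1, v^2; the last because A v^2 = (1 - w)^2 modulo \<open>p\<close>.\<close>
  also have "\<dots> = (\<Sum>t\<in>R. chi ((- A * t + (1 + w * w)) + - (1 + w * w))
      * chi ((- A * t + (1 + w * w)) * (- A * t + (1 + w * w)) - 4 * (w * w)))"
    using A by (intro sum_affine[symmetric])
      (auto intro!: arg_cong2[where f = "(*)"] chi_cong cong_mult cong_diff cong_add)
  also have "\<dots> = (\<Sum>t\<in>R. chi t * chi (t - 1) * chi (t - v * v))"
  proof (rule sum.cong)
    fix t
    have 1: "chi ((- A * t + (1 + w * w)) + - (1 + w * w)) = chi t"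
      using chi_mult[of "- A" t] chiA chi_minus by simp
    have "chi ((- A * t + (1 + w * w)) * (- A * t + (1 + w * w)) - 4 * (w * w))
       = chi ((A * A) * ((t - 1) * (t - v * v)))"
    proof (rule chi_cong)
      have "(- A * t + (1 + w * w)) * (- A * t + (1 + w * w)) - 4 * (w * w) -
        (A * A) * ((t - 1) * (t - v * v)) = A * (t - 1) * (v * v * A - (1 - w) * (1 - w))"
        by (simp add: A_def algebra_simps)
      with B show "[(- A * t + (1 + w * w)) * (- A * t + (1 + w * w)) - 4 * (w * w)
          = (A * A) * ((t - 1) * (t - v * v))] (mod p)"
        by (simp only: cong_iff_dvd_diff) simp
    qed
    then show "chi ((- A * t + (1 + w * w)) + - (1 + w * w))
      * chi ((- A * t + (1 + w * w)) * (- A * t + (1 + w * w)) - 4 * (w * w))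
      = chi t * chi (t - 1) * chi (t - v * v)"
      unfolding 1 by (simp add: chi_mult chiA)
  qed simp
  finally show ?thesis by (simp add: H_def)
qed

text \<open>Summing over c before x leaves a product of two characters in each step.\<close>

lemma sum_chi_H: "(\<Sum>c\<in>R. chi (1 - c) * H c) = 1"
proof -
  have "(\<Sum>c\<in>R. chi (1 - c) * H c)
      = (\<Sum>x\<in>R. chi x * chi (x - 1) * (\<Sum>c\<in>R. chi (c - 1) * chi (c - x)))"
    unfolding H_def sum_distrib_left
    by (subst sum.swap, intro sum.cong refl)
      (subst chi_diff_commute[of 1], subst (3) chi_diff_commute, simp only: mult_ac)
  also have "\<dots> = (\<Sum>x\<in>R. - (chi (x - 0) * chi (x - 1)))"
  proof (rule sum.cong)
    fix x
    \<comment> \<open>The exceptional value p - 1 of the inner sum occurs only at x = 1, where the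
      outer factor vanishes.\<close>
    have "chi (x - 1) = 0" if "p dvd 1 - x" using that by (simp add: chi_eq_0_iff dvd_diff_commute)
    then show "chi x * chi (x - 1) * (\<Sum>c\<in>R. chi (c - 1) * chi (c - x)) = - (chi (x - 0) * chi (x - 1))"
      by (simp add: sum_chi_chi)
  qed simp
  also have "\<dots> = 1" using p_gt_4 by (simp only: sum_negf sum_chi_chi) simp
  finally show ?thesis .
qed

lemma sum_chi_H_square: "(\<Sum>w\<in>R. chi w * H (w * w)) = K4_sum"
proof -
  let ?F = "\<lambda>w. chi w * H (w * w)" and ?G = "\<lambda>v. chi (1 - v * v) * H (v * v)"
  have F: "?F (x mod p) = ?F x" for x
    by (auto intro!: arg_cong2[where f = "(*)"] chi_cong H_cong cong_mult cong_diff)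
  have G: "?G (x mod p) = ?G x" for x
    by (auto intro!: arg_cong2[where f = "(*)"] chi_cong H_cong cong_mult cong_diff)
  \<comment> \<open>Parametrizing w = 2/u - 1 turns v = (1 - w) / (1 + w) into u - 1. The pole w =
    -1 has to be split off; it becomes u = 0 before the inversion of u.\<close>
  have "(\<Sum>w\<in>R. ?F w) = (\<Sum>u\<in>R. ?F (2 * u + -1))"
    using F not_dvd_2 by (intro sum_affine[symmetric])
  also have "\<dots> = ?F (-1) + (\<Sum>u\<in>R - {0}. ?F (2 * u + -1))"
    by (subst sum_R_minus_0) simp
  also have "?F (-1) = -1" by (simp add: H_1 chi_minus_1)
  also have "(\<Sum>u\<in>R - {0}. ?F (2 * u + -1)) = (\<Sum>u\<in>R - {0}. ?F (2 * inv_p u + -1))"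
    by (rule sum_inverse[symmetric])
  also have "\<dots> = (\<Sum>u\<in>R - {0}. ?G (u + -1))"
  proof (rule sum.cong)
    fix u assume "u \<in> R - {0}"
    then have u: "\<not> p dvd u" using dvd_R_iff by auto
    define w where "w = 2 * inv_p u + -1"
    define v where "v = u + -1"
    have "p dvd 2 * (u * inv_p u - 1)" using inv_p[OF u] by (rule dvd_mult)
    then have v: "p dvd v * (1 + w) - (1 - w)" by (simp add: v_def w_def algebra_simps)
    have w1: "\<not> p dvd 1 + w" using not_dvd_inv_p[OF u] not_dvd_2 by (simp add: w_def dvd_mult_iff)
    have "p dvd (v * (1 + w) + (1 - w)) * (v * (1 + w) - (1 - w))" using v by (rule dvd_mult)
    \<comment> \<open>Since 1 - v^2 = 4 w / (1 + w)^2, both sides differ by squares and have the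
      same character.\<close>
    then have "[(1 - v * v) * ((1 + w) * (1 + w)) = w * (2 * 2)] (mod p)"
      by (subst cong_sym_eq) (simp add: cong_iff_dvd_diff algebra_simps)
    then have "chi (1 - v * v) * (chi (1 + w) * chi (1 + w)) = chi w * (chi 2 * chi 2)"
      using chi_cong chi_mult by metis
    then have chi: "chi (1 - v * v) = chi w" using chi_square[OF w1] chi_square[OF not_dvd_2] by simp
    show "?F (2 * inv_p u + -1) = ?G (u + -1)"
    proof (cases "p dvd w")
      case True
      then show ?thesis using chi chi_eq_0_iff unfolding w_def[symmetric] v_def[symmetric] by simp
    next
      case False
      then show ?thesis using chi H_isogeny[OF False w1 v] unfolding w_def[symmetric] v_def[symmetric] by simp
    qed
  qed simp
  \<comment> \<open>The term u = 0 can be restored because 1 - v^2 vanishes at v = -1.\<close>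
  also have "\<dots> = (\<Sum>u\<in>R. ?G (u + -1))" by (subst sum_R_minus_0) simp
  also have "\<dots> = (\<Sum>v\<in>R. ?G v)" using G by (rule sum_shift)
  also have "\<dots> = (\<Sum>c\<in>R. (1 + chi c) * (chi (1 - c) * H c))"
    by (rule sum_squares) (simp add: chi_mod_add)
  also have "\<dots> = (\<Sum>c\<in>R. chi (1 - c) * H c) + K4_sum"
    unfolding K4_sum_def sum.distrib[symmetric] by (intro sum.cong refl) (simp add: distrib_right)
  \<comment> \<open>This 1 cancels the contribution -1 of w = -1.\<close>
  also have "\<dots> = 1 + K4_sum" by (simp only: sum_chi_H)
  finally show ?thesis by simp
qed

lemma K4_sum_eq: "K4_sum = J_sum\<^sup>2 - 2 * p"
proof -
  let ?f = "\<lambda>x. chi x * chi (x * x - 1)"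
  have f: "?f (x mod p) = ?f x" for x
    by (auto intro!: arg_cong2[where f = "(*)"] chi_cong H_cong cong_mult cong_diff)
  have "J_sum\<^sup>2 = (\<Sum>y\<in>R. ?f y * J_sum)" by (simp add: power2_eq_square J_sum_def sum_distrib_right)
  \<comment> \<open>For nonzero y, the variable of the second factor \<open>J_sum\<close> is written
    as w y; the character of w y * y is then \<open>chi w\<close> times that of a square.\<close>
  also have "\<dots> = (\<Sum>y\<in>R. \<Sum>w\<in>R. chi w * (chi (y * y) * chi (y * y - 1) * chi (w * w * (y * y) - 1)))"
  proof (rule sum.cong)
    fix y assume yR: "y \<in> R"
    show "?f y * J_sum = (\<Sum>w\<in>R. chi w * (chi (y * y) * chi (y * y - 1) * chi (w * w * (y * y) - 1)))"
    proof (cases "y = 0")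
      case False
      then have "\<not> p dvd y" using yR dvd_R_iff by auto
      then have "J_sum = (\<Sum>w\<in>R. ?f (y * w))"
        unfolding J_sum_def using f by (intro sum_scale[symmetric])
      then show ?thesis by (simp add: sum_distrib_left chi_mult mult_ac)
    qed simp
  qed simp
  also have "\<dots> = (\<Sum>w\<in>R. chi w * (\<Sum>y\<in>R. chi (y * y) * chi (y * y - 1) * chi (w * w * (y * y) - 1)))"
    by (subst sum.swap) (simp add: sum_distrib_left)
  \<comment> \<open>The 2 collects the -1 from \<open>sum_chi_chi\<close> and the deleted term z =
    0, where z = y^2.\<close>
  also have "\<dots> = (\<Sum>w\<in>R. chi w * ((if p dvd w * w - 1 then p else 0) - 2 + H (w * w)))"
  proof (rule sum.cong)
    fix w assume wR: "w \<in> R"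
    let ?h = "\<lambda>z. chi (z - 1) * chi (z - w * w)"
    have "(\<Sum>y\<in>R. chi (y * y) * chi (y * y - 1) * chi (w * w * (y * y) - 1))
        = (if p dvd w * w - 1 then p else 0) - 2 + H (w * w)" if "w \<noteq> 0"
    proof -
      have w: "\<not> p dvd w" using that wR dvd_R_iff by auto
      have h: "chi (z - 1) * chi (w * w * z - 1) = ?h (w * w * z)" for z
      proof -
        have "w * w * z - w * w = w * w * (z - 1)" by (simp add: algebra_simps)
        then have "chi (w * w * z - w * w) = chi (z - 1)"
          using chi_square[OF w] by (simp add: chi_mult)
        then show ?thesis by simp
      qed
      have sc: "\<not> p dvd w * w" using w by (simp add: dvd_mult_iff)
      have "(\<Sum>y\<in>R. chi (y * y) * chi (y * y - 1) * chi (w * w * (y * y) - 1))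
        = (\<Sum>z\<in>R. (1 + chi z) * (chi z * chi (z - 1) * chi (w * w * z - 1)))"
        by (rule sum_squares) (auto intro!: arg_cong2[where f = "(*)"] chi_cong cong_mult cong_diff cong_add)
      \<comment> \<open>Here (1 + chi z) chi z is the indicator of nonzero z plus
        \<open>chi z\<close>: the first part deletes z = 0, the second leads to \<open>H\<close>.
        Rescaling by the square w * w is free.\<close>
      also have "\<dots> = (\<Sum>z\<in>R. (?h (w * w * z) - of_bool (p dvd z - 0) * ?h (w * w * z)) + chi (w * w * z) * ?h (w * w * z))"
      proof (rule sum.cong)
        fix z
        have "(1 + chi z) * (chi z * chi (z - 1) * chi (w * w * z - 1))
            = (chi z + chi z * chi z) * (chi (z - 1) * chi (w * w * z - 1))" by (simp add: algebra_simps)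
        then show "(1 + chi z) * (chi z * chi (z - 1) * chi (w * w * z - 1)) =
          (?h (w * w * z) - of_bool (p dvd z - 0) * ?h (w * w * z)) + chi (w * w * z) * ?h (w * w * z)"
          unfolding h using chi_square[OF w] chi_square_eq[of z] by (auto simp: chi_mult algebra_simps)
      qed simp
      also have "\<dots> = (\<Sum>z\<in>R. ?h (w * w * z)) - (\<Sum>z\<in>R. of_bool (p dvd z - 0) * ?h (w * w * z))
          + (\<Sum>z\<in>R. chi (w * w * z) * ?h (w * w * z))"
        by (simp only: sum.distrib sum_subtractf)
      also have "(\<Sum>z\<in>R. of_bool (p dvd z - 0) * ?h (w * w * z)) = ?h (w * w * 0)"
        by (rule sum_delta_R) (auto intro!: arg_cong2[where f = "(*)"] chi_cong cong_mult cong_diff cong_add)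
      also have "?h (w * w * 0) = 1" using chi_square[OF w] by (simp add: chi_minus chi_minus_1 chi_mult)
      also have "(\<Sum>z\<in>R. ?h (w * w * z)) = (\<Sum>z\<in>R. ?h z)"
        using sc by (intro sum_scale[of ?h]) (simp add: chi_mod_add)
      also have "(\<Sum>z\<in>R. ?h z) = (if p dvd w * w - 1 then p else 0) - 1"
        by (simp add: sum_chi_chi dvd_diff_commute[of p 1])
      also have "(\<Sum>z\<in>R. chi (w * w * z) * ?h (w * w * z)) = (\<Sum>z\<in>R. chi z * ?h z)"
        using sc by (intro sum_scale[of "\<lambda>z. chi z * ?h z"]) (simp add: chi_mod_add)
      also have "\<dots> = H (w * w)" by (simp add: H_def mult_ac)
      finally show ?thesis by simp
    qed
    then show "chi w * (\<Sum>y\<in>R. chi (y * y) * chi (y * y - 1) * chi (w * w * (y * y) - 1))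
      = chi w * ((if p dvd w * w - 1 then p else 0) - 2 + H (w * w))"
      by (cases "w = 0") auto
  qed simp
  \<comment> \<open>The two distinct solutions 1 and -1 of w^2 = 1 each have character 1; together
    they give the term 2 p.\<close>
  also have "\<dots> = (\<Sum>w\<in>R. p * (of_bool (p dvd w - 1) * chi w) + p * (of_bool (p dvd w - (-1)) * chi w)
       - 2 * chi w + chi w * H (w * w))"
  proof (rule sum.cong)
    fix w :: int
    have "w * w - 1 = (w - 1) * (w - (-1))" by (simp add: algebra_simps)
    then have iff: "p dvd w * w - 1 \<longleftrightarrow> p dvd w - 1 \<or> p dvd w - (-1)" by (simp only: dvd_mult_iff)
    have "\<not> (p dvd w - 1 \<and> p dvd w - (-1))"
    proof
      assume "p dvd w - 1 \<and> p dvd w - (-1)"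
      then have "p dvd (w - (-1)) - (w - 1)" by (blast intro: dvd_diff)
      then show False using not_dvd_2 by simp
    qed
    then show "chi w * ((if p dvd w * w - 1 then p else 0) - 2 + H (w * w)) =
        p * (of_bool (p dvd w - 1) * chi w) + p * (of_bool (p dvd w - (-1)) * chi w)
       - 2 * chi w + chi w * H (w * w)"
      using iff by (auto simp: algebra_simps)
  qed simp
  also have "\<dots> = p * (\<Sum>w\<in>R. of_bool (p dvd w - 1) * chi w)
     + p * (\<Sum>w\<in>R. of_bool (p dvd w - (-1)) * chi w) - 2 * (\<Sum>w\<in>R. chi w) + (\<Sum>w\<in>R. chi w * H (w * w))"
    by (simp only: sum.distrib sum_subtractf sum_distrib_left)
  also have "\<dots> = 2 * p + K4_sum"
    by (simp only: sum_delta_R chi_mod sum_chi sum_chi_H_square) (simp add: chi_minus_1)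
  finally show ?thesis by simp
qed

subsection \<open>Sums over triples and quadruples\<close>

text \<open>The squared character is 1 except on the residue class of \<open>b\<close>, where it is
  0.\<close>

lemma sum_remove_square:
  fixes f :: "int \<Rightarrow> int"
  assumes "\<And>x. f (x mod p) = f x"
  shows "(\<Sum>x\<in>R. f x * (chi (x - b))\<^sup>2) = (\<Sum>x\<in>R. f x) - f b"
proof -
  have "(\<Sum>x\<in>R. f x * (chi (x - b))\<^sup>2) = (\<Sum>x\<in>R. f x - of_bool (p dvd x - b) * f x)"
    by (intro sum.cong) (auto simp: power2_eq_square chi_square_eq)
  then show ?thesis by (simp add: sum_subtractf sum_delta_R assms)
qed

lemma chi_diff_square: "\<not> p dvd x \<Longrightarrow> (chi x)\<^sup>2 = 1"
  by (simp add: power2_eq_square chi_square)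

text \<open>In the \<open>star\<close> lemmas a new vertex x is summed out; the digits are the
  exponents on its edges to a, b (and c).\<close>

lemma star2_22:
  assumes "\<not> p dvd a - b"
  shows "(\<Sum>x\<in>R. (chi (x - a))\<^sup>2 * (chi (x - b))\<^sup>2) = p - 2"
  using sum_remove_square[of "\<lambda>_. 1" a] sum_remove_square[of "\<lambda>x. (chi (x - a))\<^sup>2" b] p_gt_4
  by (simp add: chi_mod_add chi_diff_square chi_diff_commute[of b a] assms)

lemma star2_12: "(\<Sum>x\<in>R. chi (x - a) * (chi (x - b))\<^sup>2) = - chi (a - b)"
  using sum_remove_square[of "\<lambda>x. chi (x - a)" b]
  by (simp add: chi_mod_add sum_chi_diff chi_diff_commute[of b a])

lemma star2_21: "(\<Sum>x\<in>R. (chi (x - a))\<^sup>2 * chi (x - b)) = - chi (a - b)"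
  using star2_12[of b a] by (simp add: mult.commute chi_diff_commute[of a])

lemma star2_11: "\<not> p dvd a - b \<Longrightarrow> (\<Sum>x\<in>R. chi (x - a) * chi (x - b)) = -1"
  by (simp add: sum_chi_chi)

lemma star3_222:
  assumes "\<not> p dvd a - b" "\<not> p dvd a - c" "\<not> p dvd b - c"
  shows "(\<Sum>x\<in>R. (chi (x - a))\<^sup>2 * (chi (x - b))\<^sup>2 * (chi (x - c))\<^sup>2) = p - 3"
  using sum_remove_square[of "\<lambda>x. (chi (x - a))\<^sup>2 * (chi (x - b))\<^sup>2" c] star2_22[OF assms(1)]
  by (simp add: chi_mod_add chi_diff_square chi_diff_commute[of c] assms)

lemma star3_122:
  assumes "\<not> p dvd b - c"
  shows "(\<Sum>x\<in>R. chi (x - a) * (chi (x - b))\<^sup>2 * (chi (x - c))\<^sup>2) = - chi (a - b) - chi (a - c)"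
  using sum_remove_square[of "\<lambda>x. chi (x - a) * (chi (x - b))\<^sup>2" c] star2_12[of a b]
  by (simp add: chi_mod_add chi_diff_square chi_diff_commute[of c] assms)

lemma star3_112:
  assumes "\<not> p dvd a - b"
  shows "(\<Sum>x\<in>R. chi (x - a) * chi (x - b) * (chi (x - c))\<^sup>2) = - 1 - chi (a - c) * chi (b - c)"
  using sum_remove_square[of "\<lambda>x. chi (x - a) * chi (x - b)" c] star2_11[OF assms]
  by (simp add: chi_mod_add chi_diff_commute[of c])

text \<open>The star sum with all exponents 1. It is a sum over a cubic and stays symbolic until the
  remaining vertices are summed as well.\<close>

definition Q :: "int \<Rightarrow> int \<Rightarrow> int \<Rightarrow> int" where
  "Q a b c = (\<Sum>x\<in>R. chi (x - a) * chi (x - b) * chi (x - c))"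

text \<open>For \<open>e\<close> equal to 1 or -1 this is twice the indicator of
  \<open>chi x = e\<close>, in a polynomial form that can be expanded.\<close>

definition sel :: "int \<Rightarrow> int \<Rightarrow> int" where
  "sel e x = (chi x)\<^sup>2 + e * chi x"

text \<open>Eliminates the fourth vertex from the embedding count, leaving only \<open>Q\<close> and
  characters of the edges among a, b, c.\<close>

lemma star_sel:
  assumes "\<not> p dvd a - b" "\<not> p dvd a - c" "\<not> p dvd b - c"
  shows "(\<Sum>x\<in>R. sel e0 (x - a) * sel e1 (x - b) * sel e2 (x - c))
    = (p - 3) - e0 * (chi (a - b) + chi (a - c)) - e1 * (chi (a - b) + chi (b - c))
      - e2 * (chi (a - c) + chi (b - c)) - e0 * e1 * (1 + chi (a - c) * chi (b - c))
      - e0 * e2 * (1 + chi (a - b) * chi (b - c)) - e1 * e2 * (1 + chi (a - b) * chi (a - c))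
      + e0 * e1 * e2 * Q a b c"
proof -
  have nd: "\<not> p dvd b - a" "\<not> p dvd c - a" "\<not> p dvd c - b"
    using assms by (auto simp: dvd_diff_commute)
  have "sel e0 (x - a) * sel e1 (x - b) * sel e2 (x - c) =
      (chi (x - a))\<^sup>2 * (chi (x - b))\<^sup>2 * (chi (x - c))\<^sup>2
      + e0 * (chi (x - a) * (chi (x - b))\<^sup>2 * (chi (x - c))\<^sup>2)
      + e1 * (chi (x - b) * (chi (x - a))\<^sup>2 * (chi (x - c))\<^sup>2)
      + e2 * (chi (x - c) * (chi (x - a))\<^sup>2 * (chi (x - b))\<^sup>2)
      + e0 * e1 * (chi (x - a) * chi (x - b) * (chi (x - c))\<^sup>2)
      + e0 * e2 * (chi (x - a) * chi (x - c) * (chi (x - b))\<^sup>2)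
      + e1 * e2 * (chi (x - b) * chi (x - c) * (chi (x - a))\<^sup>2)
      + e0 * e1 * e2 * (chi (x - a) * chi (x - b) * chi (x - c))" for x
    unfolding sel_def by (simp add: algebra_simps)
  then have "(\<Sum>x\<in>R. sel e0 (x - a) * sel e1 (x - b) * sel e2 (x - c)) =
      (p - 3) + e0 * (- chi (a - b) - chi (a - c)) + e1 * (- chi (b - a) - chi (b - c))
      + e2 * (- chi (c - a) - chi (c - b)) + e0 * e1 * (- 1 - chi (a - c) * chi (b - c))
      + e0 * e2 * (- 1 - chi (a - b) * chi (c - b)) + e1 * e2 * (- 1 - chi (b - a) * chi (c - a))
      + e0 * e1 * e2 * Q a b c"
    by (simp only: sum.distrib sum_distrib_left[symmetric] Q_def[symmetric]
        star3_222[OF assms] star3_122[OF assms(1)] star3_122[OF assms(2)] star3_122[OF assms(3)]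
        star3_112[OF assms(1)] star3_112[OF assms(2)] star3_112[OF assms(3)])
  then show ?thesis
    by (simp add: chi_diff_commute[of c] chi_diff_commute[of b a] algebra_simps)
qed

section \<open>Sums over triples, with and without the factor of a fourth vertex\<close>

text \<open>An exponent \<open>2\<close> only records that the two vertices are distinct.\<close>

definition M :: "nat \<Rightarrow> nat \<Rightarrow> nat \<Rightarrow> int" where
  "M i j k = (\<Sum>x\<in>R. \<Sum>y\<in>R. \<Sum>z\<in>R. chi (x - y) ^ i * chi (x - z) ^ j * chi (y - z) ^ k)"

definition MQ :: "nat \<Rightarrow> nat \<Rightarrow> nat \<Rightarrow> int" where
  "MQ i j k = (\<Sum>x\<in>R. \<Sum>y\<in>R. \<Sum>z\<in>R.
     chi (x - y) ^ i * chi (x - z) ^ j * chi (y - z) ^ k * Q x y z)"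

lemma sum_chi_diff_square: "(\<Sum>y\<in>R. (chi (x - y))\<^sup>2) = p - 1"
  using sum_remove_square[of "\<lambda>_. 1" x] p_gt_4 by (simp add: chi_diff_commute[of x])

lemma sum_chi_diff': "(\<Sum>y\<in>R. chi (x - y)) = 0"
  using sum_chi_diff[of x] by (simp add: chi_diff_commute[of x])

text \<open>Sums out z first. The inner sum is only required for distinct x and y, because the
  factor with \<open>i > 0\<close> kills the other pairs.\<close>

lemma M_eqI:
  assumes "\<And>x y. \<not> p dvd x - y \<Longrightarrow>
    (\<Sum>z\<in>R. chi (z - x) ^ j * chi (z - y) ^ k) = v * chi (x - y) ^ l" and "i > 0"
  shows "M i j k = v * (\<Sum>x\<in>R. \<Sum>y\<in>R. chi (x - y) ^ (i + l))"
proof -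
  have "(\<Sum>z\<in>R. chi (x - y) ^ i * chi (x - z) ^ j * chi (y - z) ^ k) = v * chi (x - y) ^ (i + l)" for x y
  proof (cases "p dvd x - y")
    case True
    then show ?thesis using assms(2) by (simp add: chi_eq_0_iff[THEN iffD2] zero_power)
  next
    case False
    have "chi (x - y) ^ i * chi (x - z) ^ j * chi (y - z) ^ k
        = chi (x - y) ^ i * (chi (z - x) ^ j * chi (z - y) ^ k)" for z
      by (simp only: chi_diff_commute[of x z] chi_diff_commute[of y z] mult.assoc)
    then have "(\<Sum>z\<in>R. chi (x - y) ^ i * chi (x - z) ^ j * chi (y - z) ^ k)
       = chi (x - y) ^ i * (\<Sum>z\<in>R. chi (z - x) ^ j * chi (z - y) ^ k)"
      by (simp only: sum_distrib_left)
    then show ?thesis by (simp add: assms(1)[OF False] power_add)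
  qed
  then show ?thesis by (simp add: M_def sum_distrib_left)
qed

lemma chi_power3: "chi x ^ 3 = chi x"
  using chi_cases[of x] by auto

text \<open>After z is summed out, a pair sum with exponent 1 or 3 vanishes, and exponent 2 counts
  the p (p - 1) ordered pairs of distinct residues.\<close>

lemma M_values:
  "M 2 2 2 = p * (p - 1) * (p - 2)"
  "M 1 1 2 = - (p * (p - 1))" "M 1 2 1 = - (p * (p - 1))" "M 2 1 1 = - (p * (p - 1))"
  "M 1 2 2 = 0" "M 2 1 2 = 0" "M 2 2 1 = 0" "M 1 1 1 = 0"
proof -
  note s = sum_chi_diff_square sum_chi_diff' chi_power3
  show "M 2 2 2 = p * (p - 1) * (p - 2)"
    using M_eqI[of 2 2 "p - 2" 0 2] p_gt_4 by (simp add: star2_22 s)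
  show "M 1 1 2 = - (p * (p - 1))"
    using M_eqI[of 1 2 "- 1" 1 1] p_gt_4 by (simp add: star2_12 s numeral_2_eq_2[symmetric])
  show "M 1 2 1 = - (p * (p - 1))"
    using M_eqI[of 2 1 "- 1" 1 1] p_gt_4 by (simp add: star2_21 s numeral_2_eq_2[symmetric])
  show "M 2 1 1 = - (p * (p - 1))"
    using M_eqI[of 1 1 "- 1" 0 2] p_gt_4 by (simp add: star2_11 s)
  show "M 1 2 2 = 0"
    using M_eqI[of 2 2 "p - 2" 0 1] by (simp add: star2_22 s)
  show "M 2 1 2 = 0"
    using M_eqI[of 1 2 "- 1" 1 2] by (simp add: star2_12 s)
  show "M 2 2 1 = 0"
    using M_eqI[of 2 1 "- 1" 1 2] by (simp add: star2_21 s)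
  show "M 1 1 1 = 0"
    using M_eqI[of 1 1 "- 1" 0 1] by (simp add: star2_11 s)
qed

text \<open>Exchanges the third and the fourth vertex. The vertex summed first now has exponents 1,
  \<open>j\<close>, \<open>k\<close>, so the inner sum is elementary as soon as \<open>j\<close> or
  \<open>k\<close> is 2.\<close>

lemma MQ_swap:
  "MQ i j k = (\<Sum>x\<in>R. \<Sum>y\<in>R. \<Sum>z\<in>R. chi (x - y) ^ i * chi (x - z) * chi (y - z)
     * (\<Sum>u\<in>R. chi (u - z) * chi (u - x) ^ j * chi (u - y) ^ k))"
  unfolding MQ_def
proof (rule sum.cong[OF refl], rule sum.cong[OF refl])
  fix x y
  have "(\<Sum>z\<in>R. chi (x - y) ^ i * chi (x - z) ^ j * chi (y - z) ^ k * Q x y z)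
    = (\<Sum>z\<in>R. \<Sum>u\<in>R. chi (x - y) ^ i * chi (x - z) ^ j * chi (y - z) ^ k
        * (chi (u - x) * chi (u - y) * chi (u - z)))"
    by (simp add: Q_def sum_distrib_left)
  also have "\<dots> = (\<Sum>u\<in>R. \<Sum>z\<in>R. chi (x - y) ^ i * chi (x - z) ^ j * chi (y - z) ^ k
        * (chi (u - x) * chi (u - y) * chi (u - z)))"
    by (rule sum.swap)
  also have "\<dots> = (\<Sum>u\<in>R. chi (x - y) ^ i * chi (x - u) * chi (y - u)
     * (\<Sum>z\<in>R. chi (z - u) * chi (z - x) ^ j * chi (z - y) ^ k))"
  proof (rule sum.cong)
    fix u
    have "chi (x - y) ^ i * chi (x - z) ^ j * chi (y - z) ^ k * (chi (u - x) * chi (u - y) * chi (u - z))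
      = chi (x - y) ^ i * chi (x - u) * chi (y - u) * (chi (z - u) * chi (z - x) ^ j * chi (z - y) ^ k)" for z
      using chi_diff_commute[of x z] chi_diff_commute[of y z] chi_diff_commute[of u x]
        chi_diff_commute[of u y] chi_diff_commute[of u z] by (simp add: mult_ac)
    then show "(\<Sum>z\<in>R. chi (x - y) ^ i * chi (x - z) ^ j * chi (y - z) ^ k
        * (chi (u - x) * chi (u - y) * chi (u - z))) = chi (x - y) ^ i * chi (x - u) * chi (y - u)
     * (\<Sum>z\<in>R. chi (z - u) * chi (z - x) ^ j * chi (z - y) ^ k)"
      by (simp only: sum_distrib_left)
  qed simp
  finally show "(\<Sum>z\<in>R. chi (x - y) ^ i * chi (x - z) ^ j * chi (y - z) ^ k * Q x y z)
     = (\<Sum>z\<in>R. chi (x - y) ^ i * chi (x - z) * chi (y - z)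
     * (\<Sum>u\<in>R. chi (u - z) * chi (u - x) ^ j * chi (u - y) ^ k))" .
qed

lemma MQ_22: assumes "i > 0" shows "MQ i 2 2 = - M i 2 1 - M i 1 2"
proof -
  have "chi (x - y) ^ i * chi (x - z) * chi (y - z)
     * (\<Sum>u\<in>R. chi (u - z) * chi (u - x) ^ 2 * chi (u - y) ^ 2)
     = - (chi (x - y) ^ i * chi (x - z) ^ 2 * chi (y - z) ^ 1)
       - chi (x - y) ^ i * chi (x - z) ^ 1 * chi (y - z) ^ 2" for x y z
  proof (cases "p dvd x - y")
    case True
    then show ?thesis using assms by (simp add: chi_eq_0_iff[THEN iffD2] zero_power)
  next
    case False
    have eq: "(\<Sum>u\<in>R. chi (u - z) * chi (u - x) ^ 2 * chi (u - y) ^ 2) = - chi (x - z) - chi (y - z)"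
      using star3_122[OF False, of z] chi_diff_commute[of z] by simp
    show ?thesis unfolding eq by (simp add: algebra_simps power2_eq_square)
  qed
  then show ?thesis
    unfolding MQ_swap M_def by (simp only: sum_subtractf sum_negf)
qed

text \<open>\<open>star3_112\<close> requires z and x to be distinct; otherwise the outer factor
  \<open>chi (x - z)\<close> is 0.\<close>

lemma MQ_12: "MQ i 1 2 = - M i 1 1 - M (i + 1) 1 2"
proof -
  have "chi (x - y) ^ i * chi (x - z) * chi (y - z)
     * (\<Sum>u\<in>R. chi (u - z) * chi (u - x) ^ 1 * chi (u - y) ^ 2)
     = - (chi (x - y) ^ i * chi (x - z) ^ 1 * chi (y - z) ^ 1)
       - chi (x - y) ^ (i + 1) * chi (x - z) ^ 1 * chi (y - z) ^ 2" for x y z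
  proof (cases "p dvd z - x")
    case True
    then have "chi (x - z) = 0" by (simp add: chi_eq_0_iff dvd_diff_commute)
    then show ?thesis by simp
  next
    case False
    have eq: "(\<Sum>u\<in>R. chi (u - z) * chi (u - x) ^ 1 * chi (u - y) ^ 2) = - 1 - chi (y - z) * chi (x - y)"
      using star3_112[OF False, of y] chi_diff_commute[of z y] by simp
    show ?thesis unfolding eq by (simp add: algebra_simps power2_eq_square)
  qed
  then show ?thesis
    unfolding MQ_swap M_def by (simp only: sum_subtractf sum_negf)
qed

lemma MQ_21: "MQ i 2 1 = - M i 1 1 - M (i + 1) 2 1"
proof -
  have "chi (x - y) ^ i * chi (x - z) * chi (y - z)
     * (\<Sum>u\<in>R. chi (u - z) * chi (u - x) ^ 2 * chi (u - y) ^ 1)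
     = - (chi (x - y) ^ i * chi (x - z) ^ 1 * chi (y - z) ^ 1)
       - chi (x - y) ^ (i + 1) * chi (x - z) ^ 2 * chi (y - z) ^ 1" for x y z
  proof (cases "p dvd z - y")
    case True
    then have "chi (y - z) = 0" by (simp add: chi_eq_0_iff dvd_diff_commute)
    then show ?thesis by simp
  next
    case False
    have eq: "(\<Sum>u\<in>R. chi (u - z) * chi (u - x) ^ 2 * chi (u - y) ^ 1) = - 1 - chi (x - z) * chi (x - y)"
      using star3_112[OF False, of x] chi_diff_commute[of z x] chi_diff_commute[of y x]
      by (simp add: mult_ac)
    show ?thesis unfolding eq by (simp add: algebra_simps power2_eq_square)
  qed
  then show ?thesis
    unfolding MQ_swap M_def by (simp only: sum_subtractf sum_negf)
qed

lemma Q_commute: "Q x y z = Q x z y"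
  by (simp add: Q_def mult_ac)

text \<open>With both exponents at z equal to 1, \<open>MQ_swap\<close> does not give an elementary
  sum. Interchanging y and z, under which \<open>Q\<close> is symmetric, moves the exponent 2 to
  another edge.\<close>

lemma MQ_211: "MQ 2 1 1 = MQ 1 2 1"
proof -
  have "(\<Sum>y\<in>R. \<Sum>z\<in>R. chi (x - y) ^ 2 * chi (x - z) ^ 1 * chi (y - z) ^ 1 * Q x y z)
    = (\<Sum>z\<in>R. \<Sum>y\<in>R. chi (x - z) ^ 1 * chi (x - y) ^ 2 * chi (z - y) ^ 1 * Q x z y)" for x
    by (subst sum.swap) (simp only: Q_commute[of x] chi_diff_commute mult_ac)
  then show ?thesis by (simp only: MQ_def)
qed

text \<open>Translation moves x to 0 and scaling moves y to 1; the factor p (p - 1) counts the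
  choices of x and y.\<close>

lemma MQ_111: "MQ 1 1 1 = p * (p - 1) * K4_sum"
proof -
  let ?h = "\<lambda>x y z u. chi (y - x) * chi (z - x) * chi (y - z) * (chi (u - x) * chi (u - y) * chi (u - z))"
  let ?g = "\<lambda>y z u. chi y * chi z * chi (y - z) * (chi u * chi (u - y) * chi (u - z))"
  have inner: "(\<Sum>y\<in>R. \<Sum>z\<in>R. \<Sum>u\<in>R. ?h x y z u) = (p - 1) * K4_sum" for x
  proof -
    have "(\<Sum>y\<in>R. \<Sum>z\<in>R. \<Sum>u\<in>R. ?h x y z u)
       = (\<Sum>y\<in>R. \<Sum>z\<in>R. \<Sum>u\<in>R. ?h x (y + x) z u)"
      by (rule sum_shift[symmetric]) (simp add: chi_mod_add)
    also have "\<dots> = (\<Sum>y\<in>R. \<Sum>z\<in>R. \<Sum>u\<in>R. ?h x (y + x) (z + x) u)"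
      by (rule sum.cong[OF refl], rule sum_shift[symmetric]) (simp add: chi_mod_add)
    also have "\<dots> = (\<Sum>y\<in>R. \<Sum>z\<in>R. \<Sum>u\<in>R. ?h x (y + x) (z + x) (u + x))"
      by (rule sum.cong[OF refl], rule sum.cong[OF refl], rule sum_shift[symmetric])
        (simp add: chi_mod_add)
    also have "\<dots> = (\<Sum>y\<in>R. \<Sum>z\<in>R. \<Sum>u\<in>R. ?g y z u)" by simp
    also have "\<dots> = (\<Sum>y\<in>R - {0}. \<Sum>z\<in>R. \<Sum>u\<in>R. ?g y z u)"
      by (subst sum_R_minus_0) simp
    also have "\<dots> = (\<Sum>y\<in>R - {0}. K4_sum)"
    proof (rule sum.cong)
      fix y assume "y \<in> R - {0}"
      then have y: "\<not> p dvd y" using dvd_R_iff by auto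
      have g: "?g y (y * z) (y * u) = chi z * chi (1 - z) * (chi u * chi (u - 1) * chi (u - z))" for z u
      proof -
        have eq: "y - y * z = y * (1 - z)" "y * u - y = y * (u - 1)" "y * u - y * z = y * (u - z)"
          by (simp_all add: algebra_simps)
        \<comment> \<open>Scaling produces one factor \<open>chi y\<close> for each of the six
          edges, so they pair off into squares.\<close>
        have "?g y (y * z) (y * u) = (chi y * chi y) * (chi y * chi y) * (chi y * chi y)
          * (chi z * chi (1 - z) * (chi u * chi (u - 1) * chi (u - z)))"
          unfolding eq chi_mult by (simp only: mult_ac)
        then show ?thesis by (simp add: chi_square[OF y])
      qed
      have "(\<Sum>z\<in>R. \<Sum>u\<in>R. ?g y z u) = (\<Sum>z\<in>R. \<Sum>u\<in>R. ?g y (y * z) u)"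
        using y by (intro sum_scale[symmetric]) (simp_all add: chi_mod_add)
      also have "\<dots> = (\<Sum>z\<in>R. \<Sum>u\<in>R. ?g y (y * z) (y * u))"
        by (rule sum.cong[OF refl], rule sum_scale[symmetric]) (simp_all add: y chi_mod_add)
      also have "\<dots> = K4_sum" unfolding g by (simp add: K4_sum_def H_def sum_distrib_left)
      finally show "(\<Sum>z\<in>R. \<Sum>u\<in>R. ?g y z u) = K4_sum" .
    qed simp
    also have "\<dots> = (p - 1) * K4_sum" using p_gt_4 by simp
    finally show ?thesis .
  qed
  have "MQ 1 1 1 = (\<Sum>x\<in>R. \<Sum>y\<in>R. \<Sum>z\<in>R. \<Sum>u\<in>R. ?h x y z u)"
    unfolding MQ_def Q_def sum_distrib_left
  proof (intro sum.cong refl)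
    fix x y z u
    show "chi (x - y) ^ 1 * chi (x - z) ^ 1 * chi (y - z) ^ 1 * (chi (u - x) * chi (u - y) * chi (u - z)) = ?h x y z u"
      using chi_diff_commute[of x y] chi_diff_commute[of x z] by simp
  qed
  also have "\<dots> = p * (p - 1) * K4_sum" using p_gt_4 by (simp only: inner) simp
  finally show ?thesis .
qed

lemma MQ_values:
  "MQ 2 2 2 = 0" "MQ 1 1 2 = 0" "MQ 1 2 1 = 0" "MQ 2 1 1 = 0"
  "MQ 1 2 2 = 2 * (p * (p - 1))" "MQ 2 1 2 = 2 * (p * (p - 1))" "MQ 2 2 1 = 2 * (p * (p - 1))"
  "MQ 1 1 1 = p * (p - 1) * K4_sum"
proof -
  \<comment> \<open>\<open>MQ_12\<close> and \<open>MQ_21\<close> at i = 2 raise the first exponent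
    to 3.\<close>
  have M3: "M 3 j k = M 1 j k" for j k by (simp add: M_def chi_power3)
  show "MQ 2 2 2 = 0" "MQ 1 1 2 = 0" "MQ 1 2 1 = 0"
    using MQ_22[of 2] MQ_12[of 1] MQ_21[of 1] M_values by (simp_all del: One_nat_def)
  then show "MQ 2 1 1 = 0" by (simp only: MQ_211)
  show "MQ 1 2 2 = 2 * (p * (p - 1))" "MQ 2 1 2 = 2 * (p * (p - 1))" "MQ 2 2 1 = 2 * (p * (p - 1))"
    using MQ_22[of 1] MQ_12[of 2] MQ_21[of 2] M_values by (simp_all add: M3 del: One_nat_def)
qed (rule MQ_111)

section \<open>The signed sum over quadruples\<close>

text \<open>On vertices \<open>0, 1, 2, 3\<close> the signs belong to the edges \<open>01, 02, 12, 03, 13, 23\<close>. The five groups of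
  terms come from the edge sets that are paths of length two, perfect matchings, paws, 4-cycles, and
  \<open>K\<^sub>4\<close>.\<close>

lemma sum_pattern:
  fixes al be ga e0 e1 e2 :: int
  shows "(\<Sum>x\<in>R. \<Sum>y\<in>R. \<Sum>z\<in>R. \<Sum>u\<in>R.
      sel al (x - y) * sel be (x - z) * sel ga (y - z) * sel e0 (u - x) * sel e1 (u - y) * sel e2 (u - z))
    = p * (p - 1) * ((p - 2) * (p - 3)
      - (p - 3) * ((al + e2) * (be + e1) + (al + e2) * (ga + e0) + (be + e1) * (ga + e0))
      + 2 * (al * e2 + be * e1 + ga * e0)
      + 2 * (al * be * ga * (e0 + e1 + e2) + al * e0 * e1 * (be + ga + e2)
        + be * e0 * e2 * (al + ga + e1) + ga * e1 * e2 * (al + be + e0))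
      - (p - 3) * (be * e1 * ga * e0 + al * e2 * ga * e0 + al * e2 * be * e1)
      + al * be * ga * e0 * e1 * e2 * K4_sum)"
proof -
  \<comment> \<open>The coefficients of \<open>a\<^sup>i b\<^sup>j c\<^sup>k\<close> after reduction by \<open>a\<^sup>3 = a\<close>, \<open>b\<^sup>3 = b\<close>, \<open>c\<^sup>3 = c\<close>.\<close>
  define c111 where
    "c111 = - e1 * e2 * ga - e0 * e2 * be - e0 * be * ga - e1 * be * ga - e0 * e1 * al - e0 * al * ga -
      e2 * al * ga - e1 * al * be - e2 * al * be + (p - 3) * al * be * ga - e0 * e1 * al * be * ga
      - e0 * e2 * al * be * ga - e1 * e2 * al * be * ga"
  define c112 where
    "c112 = - e1 * e2 - e0 * be - e1 * be - e0 * e2 * be * ga - e0 * al - e2 * al - e0 * e1 * al * ga +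
      (p - 3) * al * be - e0 * e1 * al * be - e0 * e2 * al * be - e1 * e2 * al * be - e1 * al * be
      * ga - e2 * al * be * ga"
  define c121 where
    "c121 = - e0 * e2 - e0 * ga - e1 * ga - e1 * e2 * be * ga - e1 * al - e2 * al + (p - 3) * al * ga -
      e0 * e1 * al * ga - e0 * e2 * al * ga - e1 * e2 * al * ga - e0 * e1 * al * be - e0 * al * be
      * ga - e2 * al * be * ga"
  define c122 where
    "c122 = - e0 - e1 - e0 * e2 * ga - e1 * e2 * be + (p - 3) * al - e0 * e1 * al - e0 * e2 * al - e1 *
      e2 * al - e1 * al * ga - e2 * al * ga - e0 * al * be - e2 * al * be - e0 * e1 * al * be * ga"
  define c211 where
    "c211 = - e0 * e1 - e0 * ga - e2 * ga - e1 * be - e2 * be + (p - 3) * be * ga - e0 * e1 * be * ga -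
      e0 * e2 * be * ga - e1 * e2 * be * ga - e1 * e2 * al * ga - e0 * e2 * al * be - e0 * al * be
      * ga - e1 * al * be * ga"
  define c212 where
    "c212 = - e0 - e2 - e0 * e1 * ga + (p - 3) * be - e0 * e1 * be - e0 * e2 * be - e1 * e2 * be - e1 *
      be * ga - e2 * be * ga - e1 * e2 * al - e0 * al * be - e1 * al * be - e0 * e2 * al * be * ga"
  define c221 where
    "c221 = - e1 - e2 + (p - 3) * ga - e0 * e1 * ga - e0 * e2 * ga - e1 * e2 * ga - e0 * e1 * be - e0 *
      be * ga - e2 * be * ga - e0 * e2 * al - e0 * al * ga - e1 * al * ga - e1 * e2 * al * be * ga"
  define c222 where
    "c222 = (p - 3) - e0 * e1 - e0 * e2 - e1 * e2 - e1 * ga - e2 * ga - e0 * be - e2 * be - e0 * e1 * be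
      * ga - e0 * al - e1 * al - e0 * e2 * al * ga - e1 * e2 * al * be"
  note cs = c111_def c112_def c121_def c122_def c211_def c212_def c221_def c222_def
  \<comment> \<open>Here a, b, c stand for the characters of the edges among x, y, z and q for
    \<open>Q\<close>. The identity uses that a, b, c lie in {-1, 0, 1} and is checked in all 27
    cases.\<close>
  have red: "(a\<^sup>2 + al * a) * (b\<^sup>2 + be * b) * (c\<^sup>2 + ga * c) * ((p - 3) - e0 * (a + b) - e1 * (a + c) - e2 * (b + c)
      - e0 * e1 * (1 + b * c) - e0 * e2 * (1 + a * c) - e1 * e2 * (1 + a * b) + e0 * e1 * e2 * q)
     = c111 * (a ^ 1 * b ^ 1 * c ^ 1)
      + c112 * (a ^ 1 * b ^ 1 * c ^ 2)
      + c121 * (a ^ 1 * b ^ 2 * c ^ 1)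
      + c122 * (a ^ 1 * b ^ 2 * c ^ 2)
      + c211 * (a ^ 2 * b ^ 1 * c ^ 1)
      + c212 * (a ^ 2 * b ^ 1 * c ^ 2)
      + c221 * (a ^ 2 * b ^ 2 * c ^ 1)
      + c222 * (a ^ 2 * b ^ 2 * c ^ 2)
       + ((al * be * ga * e0 * e1 * e2) * (a ^ 1 * b ^ 1 * c ^ 1 * q)
      + (al * be * e0 * e1 * e2) * (a ^ 1 * b ^ 1 * c ^ 2 * q)
      + (al * ga * e0 * e1 * e2) * (a ^ 1 * b ^ 2 * c ^ 1 * q)
      + (al * e0 * e1 * e2) * (a ^ 1 * b ^ 2 * c ^ 2 * q)
      + (be * ga * e0 * e1 * e2) * (a ^ 2 * b ^ 1 * c ^ 1 * q)
      + (be * e0 * e1 * e2) * (a ^ 2 * b ^ 1 * c ^ 2 * q)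
      + (ga * e0 * e1 * e2) * (a ^ 2 * b ^ 2 * c ^ 1 * q)
      + (e0 * e1 * e2) * (a ^ 2 * b ^ 2 * c ^ 2 * q))"
    if "a = -1 \<or> a = 0 \<or> a = 1" "b = -1 \<or> b = 0 \<or> b = 1" "c = -1 \<or> c = 0 \<or> c = 1" for a b c q :: int
    using that unfolding cs by (elim disjE; hypsubst) (simp_all add: algebra_simps)
  have "(\<Sum>u\<in>R. sel al (x - y) * sel be (x - z) * sel ga (y - z) * sel e0 (u - x) * sel e1 (u - y) * sel e2 (u - z))
    = c111 * (chi (x - y) ^ 1 * chi (x - z) ^ 1 * chi (y - z) ^ 1)
      + c112 * (chi (x - y) ^ 1 * chi (x - z) ^ 1 * chi (y - z) ^ 2)
      + c121 * (chi (x - y) ^ 1 * chi (x - z) ^ 2 * chi (y - z) ^ 1)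
      + c122 * (chi (x - y) ^ 1 * chi (x - z) ^ 2 * chi (y - z) ^ 2)
      + c211 * (chi (x - y) ^ 2 * chi (x - z) ^ 1 * chi (y - z) ^ 1)
      + c212 * (chi (x - y) ^ 2 * chi (x - z) ^ 1 * chi (y - z) ^ 2)
      + c221 * (chi (x - y) ^ 2 * chi (x - z) ^ 2 * chi (y - z) ^ 1)
      + c222 * (chi (x - y) ^ 2 * chi (x - z) ^ 2 * chi (y - z) ^ 2)
       + ((al * be * ga * e0 * e1 * e2) * (chi (x - y) ^ 1 * chi (x - z) ^ 1 * chi (y - z) ^ 1 * Q x y z)
      + (al * be * e0 * e1 * e2) * (chi (x - y) ^ 1 * chi (x - z) ^ 1 * chi (y - z) ^ 2 * Q x y z)
      + (al * ga * e0 * e1 * e2) * (chi (x - y) ^ 1 * chi (x - z) ^ 2 * chi (y - z) ^ 1 * Q x y z)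
      + (al * e0 * e1 * e2) * (chi (x - y) ^ 1 * chi (x - z) ^ 2 * chi (y - z) ^ 2 * Q x y z)
      + (be * ga * e0 * e1 * e2) * (chi (x - y) ^ 2 * chi (x - z) ^ 1 * chi (y - z) ^ 1 * Q x y z)
      + (be * e0 * e1 * e2) * (chi (x - y) ^ 2 * chi (x - z) ^ 1 * chi (y - z) ^ 2 * Q x y z)
      + (ga * e0 * e1 * e2) * (chi (x - y) ^ 2 * chi (x - z) ^ 2 * chi (y - z) ^ 1 * Q x y z)
      + (e0 * e1 * e2) * (chi (x - y) ^ 2 * chi (x - z) ^ 2 * chi (y - z) ^ 2 * Q x y z))" (is "?L = ?r") for x y z
  proof -
    have "?L = sel al (x - y) * sel be (x - z) * sel ga (y - z) *
       (\<Sum>u\<in>R. sel e0 (u - x) * sel e1 (u - y) * sel e2 (u - z))"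
      by (simp add: sum_distrib_left mult.assoc)
    also have "\<dots> = sel al (x - y) * sel be (x - z) * sel ga (y - z) *
       ((p - 3) - e0 * (chi (x - y) + chi (x - z))
         - e1 * (chi (x - y) + chi (y - z))
         - e2 * (chi (x - z) + chi (y - z))
      - e0 * e1 * (1 + chi (x - z) * chi (y - z)) - e0 * e2 * (1 + chi (x - y) * chi (y - z))
         - e1 * e2 * (1 + chi (x - y) * chi (x - z)) + e0 * e1 * e2 * Q x y z)"
    \<comment> \<open>\<open>star_sel\<close> needs three distinct vertices; if two coincide, the
      corresponding outer factor \<open>sel\<close> makes both sides 0.\<close>
    proof (cases "p dvd x - y \<or> p dvd x - z \<or> p dvd y - z")
      case True
      then show ?thesis by (elim disjE) (simp_all add: sel_def chi_eq_0_iff[THEN iffD2])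
    next
      case False
      then show ?thesis by (simp add: star_sel)
    qed
    also have "\<dots> = ?r"
      unfolding sel_def by (rule red) (rule chi_cases)+
    finally show ?thesis .
  qed
  then have "(\<Sum>x\<in>R. \<Sum>y\<in>R. \<Sum>z\<in>R. \<Sum>u\<in>R.
      sel al (x - y) * sel be (x - z) * sel ga (y - z) * sel e0 (u - x) * sel e1 (u - y) * sel e2 (u - z))
    = c111 * M 1 1 1
      + c112 * M 1 1 2
      + c121 * M 1 2 1
      + c122 * M 1 2 2
      + c211 * M 2 1 1
      + c212 * M 2 1 2
      + c221 * M 2 2 1
      + c222 * M 2 2 2
       + ((al * be * ga * e0 * e1 * e2) * MQ 1 1 1
      + (al * be * e0 * e1 * e2) * MQ 1 1 2
      + (al * ga * e0 * e1 * e2) * MQ 1 2 1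
      + (al * e0 * e1 * e2) * MQ 1 2 2
      + (be * ga * e0 * e1 * e2) * MQ 2 1 1
      + (be * e0 * e1 * e2) * MQ 2 1 2
      + (ga * e0 * e1 * e2) * MQ 2 2 1
      + (e0 * e1 * e2) * MQ 2 2 2)"
    by (simp only: M_def MQ_def sum.distrib sum_distrib_left)
  \<comment> \<open>Only \<open>M\<close> with exponents 222 or two 1s and a 2 survives, and
    \<open>MQ\<close> with exponents 111 or one 1 and two 2s.\<close>
  also have "\<dots> = p * (p - 1) * ((p - 2) * c222 - c112 - c121 - c211
      + 2 * (e0 * e1 * e2 * (al + be + ga)) + al * be * ga * e0 * e1 * e2 * K4_sum)"
    by (simp add: M_values MQ_values del: One_nat_def) (simp add: algebra_simps)
  finally show ?thesis unfolding cs by (simp add: algebra_simps)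
qed

end

subsection \<open>Embeddings, good sets and translation classes\<close>

definition edge_sign :: "(nat \<Rightarrow> nat \<Rightarrow> bool) \<Rightarrow> nat \<Rightarrow> nat \<Rightarrow> int" where
  "edge_sign E i j = (if E i j then 1 else -1)"

text \<open>Functions are extensional, so each automorphism of the vertex set is counted
  once.\<close>

definition automorphisms :: "nat set \<Rightarrow> (nat \<Rightarrow> nat \<Rightarrow> bool) \<Rightarrow> (nat \<Rightarrow> nat) set" where
  "automorphisms V E = {g \<in> V \<rightarrow>\<^sub>E V. bij_betw g V V \<and> (\<forall>x\<in>V. \<forall>y\<in>V. E (g x) (g y) \<longleftrightarrow> E x y)}"

lemma finite_automorphisms: "finite V \<Longrightarrow> finite (automorphisms V E)"
  unfolding automorphisms_def by (rule finite_subset[OF _ finite_PiE[of V "\<lambda>_. V"]]) auto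

lemma card_automorphisms_pos: "finite V \<Longrightarrow> card (automorphisms V E) > 0"
proof -
  assume V: "finite V"
  have "(\<lambda>i\<in>V. i) \<in> automorphisms V E"
    unfolding automorphisms_def by (auto simp: bij_betw_def inj_on_def image_def)
  then show ?thesis using finite_automorphisms[OF V] card_gt_0_iff by blast
qed

lemma card_automorphisms_K4: "card (automorphisms {0..<4} (\<lambda>x y. x \<noteq> y)) = 24"
proof -
  have "automorphisms {0..<4} (\<lambda>x y. x \<noteq> y) = {f \<in> {0..<4} \<rightarrow>\<^sub>E {0..<4}. inj_on f {0..<4}}"
  proof (intro equalityI subsetI)
    fix f :: "nat \<Rightarrow> nat" assume f: "f \<in> {f \<in> {0..<4} \<rightarrow>\<^sub>E {0..<4}. inj_on f {0..<4}}"
    then have "f ` {0..<4} \<subseteq> {0..<4}" by blast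
    with f have "bij_betw f {0..<4} {0..<4}" by (simp add: bij_betw_def endo_inj_surj)
    with f show "f \<in> automorphisms {0..<4} (\<lambda>x y. x \<noteq> y)"
      unfolding automorphisms_def by (auto dest: inj_onD)
  qed (auto simp: automorphisms_def bij_betw_def)
  then show ?thesis
    by (simp add: card_inj_on_subset_funcset numeral_eq_Suc)
qed

context prime_1_mod_4
begin

text \<open>Prescribing a value 1 or -1 of \<open>chi\<close> on every pair encodes edges, non-edges
  and injectivity at once, so membership is a product of conditions on edges.\<close>

definition embeddings :: "nat set \<Rightarrow> (nat \<Rightarrow> nat \<Rightarrow> bool) \<Rightarrow> (nat \<Rightarrow> int) set" where
  "embeddings V E = {f \<in> V \<rightarrow>\<^sub>E R. \<forall>i\<in>V. \<forall>j\<in>V. i \<noteq> j \<longrightarrow> chi (f i - f j) = edge_sign E i j}"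

lemma qr_adj_iff: "qr_adj p x y \<longleftrightarrow> chi (x - y) = 1"
  by (simp add: qr_adj_def chi_def)

lemma good_sets_eq:
  "good_sets (nat p) V E = {S. S \<subseteq> R \<and> card S = card V \<and> graph_iso S (qr_adj p) V E}"
  using p_gt_4 by (simp add: good_sets_def)

lemma finite_good_sets: "finite (good_sets (nat p) V E)"
  unfolding good_sets_eq by (rule finite_subset[of _ "Pow R"]) auto

lemma embeddings_iff:
  assumes "\<forall>x\<in>V. \<not> E x x"
  shows "f \<in> embeddings V E \<longleftrightarrow>
    f \<in> V \<rightarrow>\<^sub>E R \<and> inj_on f V \<and> (\<forall>i\<in>V. \<forall>j\<in>V. qr_adj p (f i) (f j) \<longleftrightarrow> E i j)"
proof (intro iffI conjI)
  assume f: "f \<in> embeddings V E"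
  then have sign: "chi (f i - f j) = edge_sign E i j" if "i \<in> V" "j \<in> V" "i \<noteq> j" for i j
    using that unfolding embeddings_def by blast
  show "f \<in> V \<rightarrow>\<^sub>E R" using f unfolding embeddings_def by blast
  show "inj_on f V"
  proof (rule inj_onI, rule ccontr)
    fix i j assume "i \<in> V" "j \<in> V" "f i = f j" "i \<noteq> j"
    with sign[of i j] show False by (auto simp: edge_sign_def split: if_splits)
  qed
  show "\<forall>i\<in>V. \<forall>j\<in>V. qr_adj p (f i) (f j) \<longleftrightarrow> E i j"
  proof (intro ballI)
    fix i j assume "i \<in> V" "j \<in> V"
    then show "qr_adj p (f i) (f j) \<longleftrightarrow> E i j"
      using sign[of i j] assms by (cases "i = j") (auto simp: qr_adj_iff edge_sign_def)
  qed
next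
  assume f: "f \<in> V \<rightarrow>\<^sub>E R \<and> inj_on f V \<and> (\<forall>i\<in>V. \<forall>j\<in>V. qr_adj p (f i) (f j) \<longleftrightarrow> E i j)"
  have "chi (f i - f j) = edge_sign E i j" if ij: "i \<in> V" "j \<in> V" "i \<noteq> j" for i j
  proof -
    have "f i \<noteq> f j" using f ij by (auto dest: inj_onD)
    moreover have "f i \<in> R" "f j \<in> R" using f ij PiE_mem[of f V "\<lambda>_. R"] by blast+
    ultimately have "chi (f i - f j) \<noteq> 0" by (simp only: chi_eq_0_iff dvd_diff_R_iff not_False_eq_True)
    moreover have "chi (f i - f j) = 1 \<longleftrightarrow> E i j" using f ij by (simp add: qr_adj_iff)
    ultimately show ?thesis using chi_cases[of "f i - f j"] by (auto simp: edge_sign_def)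
  qed
  with f show "f \<in> embeddings V E" unfolding embeddings_def by blast
qed

text \<open>Embeddings are grouped by their image. Once a good set S is identified with
  \<open>V\<close>, composition with that identification matches automorphisms with embeddings of
  image S.\<close>

lemma card_embeddings:
  assumes V: "finite V" and irr: "\<forall>x\<in>V. \<not> E x x"
  shows "card (embeddings V E) = card (good_sets (nat p) V E) * card (automorphisms V E)"
proof -
  let ?fib = "\<lambda>S. {f \<in> embeddings V E. f ` V = S}"
  have fin: "finite (embeddings V E)"
    unfolding embeddings_def using V by (intro finite_subset[OF _ finite_PiE[of V "\<lambda>_. R"]]) auto
  have img: "(\<lambda>f. f ` V) ` embeddings V E \<subseteq> good_sets (nat p) V E"
  proof
    fix S assume "S \<in> (\<lambda>f. f ` V) ` embeddings V E"
    then obtain f where f: "f \<in> V \<rightarrow>\<^sub>E R" "inj_on f V"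
        "\<forall>i\<in>V. \<forall>j\<in>V. qr_adj p (f i) (f j) \<longleftrightarrow> E i j" and S: "S = f ` V"
      using embeddings_iff[of V E] irr by auto
    have "bij_betw (inv_into V f) S V"
      unfolding S using f(2) by (simp add: bij_betw_inv_into inj_on_imp_bij_betw)
    moreover have "\<forall>x\<in>S. \<forall>y\<in>S. qr_adj p x y \<longleftrightarrow> E (inv_into V f x) (inv_into V f y)"
      using f(2,3) S by auto
    ultimately have "graph_iso S (qr_adj p) V E" unfolding graph_iso_def by blast
    then show "S \<in> good_sets (nat p) V E"
      unfolding good_sets_eq using f S by (auto simp: card_image)
  qed
  have card_fib: "card (?fib S) = card (automorphisms V E)" if S: "S \<in> good_sets (nat p) V E" for S
  proof -
    obtain h where h: "bij_betw h S V" and hE: "\<forall>x\<in>S. \<forall>y\<in>S. qr_adj p x y \<longleftrightarrow> E (h x) (h y)"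
      using S unfolding good_sets_eq graph_iso_def by blast
    have SR: "S \<subseteq> R" using S unfolding good_sets_eq by blast
    define u where "u = inv_into S h"
    have u: "bij_betw u V S" unfolding u_def using h by (rule bij_betw_inv_into)
    have hu: "h (u i) = i" if "i \<in> V" for i
      unfolding u_def using h that by (rule bij_betw_inv_into_right)
    have uh: "u (h x) = x" if "x \<in> S" for x
      unfolding u_def using h that by (rule bij_betw_inv_into_left)
    have uS: "u i \<in> S" if "i \<in> V" for i using u that by (rule bij_betwE[THEN bspec])
    have hV: "h x \<in> V" if "x \<in> S" for x using h that by (rule bij_betwE[THEN bspec])
    have "bij_betw (\<lambda>g. \<lambda>i\<in>V. u (g i)) (automorphisms V E) (?fib S)"
    proof (rule bij_betw_byWitness[where f' = "\<lambda>f. \<lambda>i\<in>V. h (f i)"])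
      show "\<forall>g\<in>automorphisms V E. (\<lambda>i\<in>V. h ((\<lambda>i\<in>V. u (g i)) i)) = g"
      proof
        fix g assume "g \<in> automorphisms V E"
        then have "g \<in> V \<rightarrow>\<^sub>E V" unfolding automorphisms_def by blast
        then show "(\<lambda>i\<in>V. h ((\<lambda>i\<in>V. u (g i)) i)) = g"
          using hu by (intro ext) (auto simp: restrict_def PiE_def extensional_def Pi_def)
      qed
      show "\<forall>f\<in>?fib S. (\<lambda>i\<in>V. u ((\<lambda>i\<in>V. h (f i)) i)) = f"
      proof
        fix f assume "f \<in> ?fib S"
        then have "f \<in> V \<rightarrow>\<^sub>E R" "f ` V = S" unfolding embeddings_def by blast+
        then show "(\<lambda>i\<in>V. u ((\<lambda>i\<in>V. h (f i)) i)) = f"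
          using uh by (intro ext) (auto simp: restrict_def PiE_def extensional_def)
      qed
      show "(\<lambda>g. \<lambda>i\<in>V. u (g i)) ` automorphisms V E \<subseteq> ?fib S"
      proof
        fix f assume "f \<in> (\<lambda>g. \<lambda>i\<in>V. u (g i)) ` automorphisms V E"
        then obtain g where g: "bij_betw g V V" "\<forall>x\<in>V. \<forall>y\<in>V. E (g x) (g y) \<longleftrightarrow> E x y"
            and f: "f = (\<lambda>i\<in>V. u (g i))"
          unfolding automorphisms_def by blast
        have gV: "g i \<in> V" if "i \<in> V" for i using g(1) that by (rule bij_betwE[THEN bspec])
        have "bij_betw (u \<circ> g) V S" using g(1) u by (rule bij_betw_trans)
        then have bij: "bij_betw f V S" unfolding f by (simp cong: bij_betw_cong)
        have "f \<in> V \<rightarrow>\<^sub>E R" unfolding f using gV uS SR by auto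
        moreover have "\<forall>i\<in>V. \<forall>j\<in>V. qr_adj p (f i) (f j) \<longleftrightarrow> E i j"
          using g(2) hE gV uS hu by (simp add: f)
        ultimately show "f \<in> ?fib S"
          using bij embeddings_iff[of V E f] irr by (simp add: bij_betw_def)
      qed
      show "(\<lambda>f. \<lambda>i\<in>V. h (f i)) ` ?fib S \<subseteq> automorphisms V E"
      proof
        fix g assume "g \<in> (\<lambda>f. \<lambda>i\<in>V. h (f i)) ` ?fib S"
        then obtain f where f: "inj_on f V" "f ` V = S"
            "\<forall>i\<in>V. \<forall>j\<in>V. qr_adj p (f i) (f j) \<longleftrightarrow> E i j" and g: "g = (\<lambda>i\<in>V. h (f i))"
          using embeddings_iff[of V E] irr by auto
        have fS: "f i \<in> S" if "i \<in> V" for i using f(2) that by blast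
        have "bij_betw (h \<circ> f) V V" using f h by (intro bij_betw_trans[of f V S]) (auto simp: bij_betw_def)
        then have "bij_betw g V V" unfolding g by (simp cong: bij_betw_cong)
        moreover have "g \<in> V \<rightarrow>\<^sub>E V" unfolding g using fS hV by auto
        moreover have "\<forall>x\<in>V. \<forall>y\<in>V. E (g x) (g y) \<longleftrightarrow> E x y" using f(3) hE fS by (simp add: g)
        ultimately show "g \<in> automorphisms V E" unfolding automorphisms_def by blast
      qed
    qed
    then show ?thesis by (rule bij_betw_same_card[symmetric])
  qed
  have "card (embeddings V E) = (\<Sum>S\<in>good_sets (nat p) V E. card (?fib S))"
    using sum.group[OF fin finite_good_sets img, of "\<lambda>_. 1 :: nat"] by simp
  then show ?thesis by (simp add: card_fib)
qed

section \<open>Translation classes of good sets\<close>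

lemma inj_on_shift: "inj_on (\<lambda>x. (x + a) mod p) R"
proof (rule inj_onI)
  fix x y assume "x \<in> R" "y \<in> R" "(x + a) mod p = (y + a) mod p"
  then show "x = y" using dvd_diff_R_iff[of x y] by (simp add: mod_eq_dvd_iff)
qed

lemma shift_res_in_good_sets:
  assumes "S \<in> good_sets (nat p) V E"
  shows "shift_res p a S \<in> good_sets (nat p) V E"
proof -
  let ?s = "\<lambda>x. (x + a) mod p"
  obtain h where h: "bij_betw h S V" and hE: "\<forall>x\<in>S. \<forall>y\<in>S. qr_adj p x y \<longleftrightarrow> E (h x) (h y)"
    and S: "S \<subseteq> R" "card S = card V"
    using assms unfolding good_sets_eq graph_iso_def by blast
  have inj: "inj_on ?s S" using inj_on_shift S(1) by (rule inj_on_subset)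
  have "bij_betw (inv_into S ?s) (?s ` S) S"
    using inj by (simp add: bij_betw_inv_into inj_on_imp_bij_betw)
  then have "bij_betw (h \<circ> inv_into S ?s) (?s ` S) V" using h by (rule bij_betw_trans)
  moreover have "\<forall>x\<in>?s ` S. \<forall>y\<in>?s ` S. qr_adj p x y \<longleftrightarrow>
      E ((h \<circ> inv_into S ?s) x) ((h \<circ> inv_into S ?s) y)"
  proof (intro ballI)
    fix x' y' assume "x' \<in> ?s ` S" "y' \<in> ?s ` S"
    then obtain x y where xy: "x \<in> S" "y \<in> S" "x' = ?s x" "y' = ?s y" by blast
    have "chi (x' - y') = chi (x - y)" unfolding xy chi_mod_add by simp
    then show "qr_adj p x' y' \<longleftrightarrow> E ((h \<circ> inv_into S ?s) x') ((h \<circ> inv_into S ?s) y')"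
      using hE xy inv_into_f_f[OF inj] by (simp add: qr_adj_iff)
  qed
  ultimately have "graph_iso (?s ` S) (qr_adj p) V E" unfolding graph_iso_def by blast
  moreover have "?s ` S \<subseteq> R" using p_gt_4 by auto
  ultimately show ?thesis
    using S inj by (simp add: good_sets_eq shift_res_def card_image)
qed

lemma shift_res_shift_res: "shift_res p a (shift_res p b S) = shift_res p ((a + b) mod p) S"
  unfolding shift_res_def image_image by (intro image_cong refl) (simp add: mod_simps add_ac)

lemma shift_res_0: "S \<subseteq> R \<Longrightarrow> shift_res p 0 S = S"
  unfolding shift_res_def by (force simp: image_iff subset_iff)

lemma inj_on_shift_res:
  assumes S: "S \<subseteq> R" and nd: "\<not> p dvd int (card S)"
  shows "inj_on (\<lambda>a. shift_res p a S) R"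
proof (rule inj_onI)
  fix a b assume ab: "a \<in> R" "b \<in> R" "shift_res p a S = shift_res p b S"
  \<comment> \<open>The sum of the elements detects a translation.\<close>
  have sum: "[\<Sum>(shift_res p c S) = \<Sum>S + int (card S) * c] (mod p)" for c
  proof -
    have "\<Sum>(shift_res p c S) = (\<Sum>x\<in>S. (x + c) mod p)"
      unfolding shift_res_def using inj_on_subset[OF inj_on_shift S] by (simp add: sum.reindex)
    also have "[\<dots> = (\<Sum>x\<in>S. x + c)] (mod p)" by (intro cong_sum) simp
    also have "(\<Sum>x\<in>S. x + c) = \<Sum>S + int (card S) * c" by (simp add: sum.distrib)
    finally show ?thesis .
  qed
  have "[\<Sum>S + int (card S) * a = \<Sum>S + int (card S) * b] (mod p)"
    using sum[of a] sum[of b] ab(3) by (metis cong_sym cong_trans)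
  then have "p dvd int (card S) * (a - b)" by (simp add: cong_iff_dvd_diff algebra_simps)
  then have "p dvd a - b" using nd by (simp add: dvd_mult_iff)
  then show "a = b" using ab dvd_diff_R_iff by blast
qed

text \<open>\<open>n_p\<close> counts orbits of the translation group on good sets, and since the
  action is free every orbit has \<open>p\<close> elements.\<close>

lemma card_good_sets:
  assumes nd: "\<not> p dvd int (card V)"
  shows "card (good_sets (nat p) V E) = n_p (nat p) V E * nat p"
proof -
  let ?G = "good_sets (nat p) V E"
  define orb where "orb S = (\<lambda>a. shift_res p a S) ` R" for S
  have n_p: "n_p (nat p) V E = card (orb ` ?G)"
    using p_gt_4 unfolding n_p_def orb_def by (intro arg_cong[where f = card]) (auto simp: image_def)
  have GD: "S \<subseteq> R" "card S = card V" if "S \<in> ?G" for S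
    using that unfolding good_sets_eq by blast+
  have orb_self: "S \<in> orb S" if "S \<in> ?G" for S
    unfolding orb_def using shift_res_0[OF GD(1)[OF that]] p_gt_4 by (intro image_eqI[of _ _ 0]) auto
  have sub: "orb T \<subseteq> orb S" if "T \<in> orb S" for S T
    using that p_gt_4 unfolding orb_def by (auto simp: shift_res_shift_res)
  have orb_sym: "S \<in> orb T" if "T \<in> orb S" "S \<in> ?G" for S T
  proof -
    obtain a where a: "T = shift_res p a S" using \<open>T \<in> orb S\<close> unfolding orb_def by blast
    have "shift_res p ((- a) mod p) T = shift_res p 0 S"
      unfolding a shift_res_shift_res by (simp add: mod_simps)
    then have "S = shift_res p ((- a) mod p) T" using shift_res_0 GD(1)[OF that(2)] by simp
    then show ?thesis unfolding orb_def using p_gt_4 by (intro image_eqI) auto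
  qed
  have orbit: "{T \<in> ?G. orb T = orb S} = orb S" if S: "S \<in> ?G" for S
  proof (intro equalityI subsetI)
    fix T assume "T \<in> {T \<in> ?G. orb T = orb S}"
    then show "T \<in> orb S" using orb_self[of T] by auto
  next
    fix T assume T: "T \<in> orb S"
    then have "T \<in> ?G" using S shift_res_in_good_sets unfolding orb_def by blast
    moreover have "orb T = orb S" using sub[OF T] sub[OF orb_sym[OF T S]] by blast
    ultimately show "T \<in> {T \<in> ?G. orb T = orb S}" by blast
  qed
  have card_orb: "card (orb S) = nat p" if "S \<in> ?G" for S
    unfolding orb_def using inj_on_shift_res[of S] GD[OF that] nd by (simp add: card_image)
  have "card ?G = (\<Sum>C\<in>orb ` ?G. card {T \<in> ?G. orb T = C})"
    using sum.group[where g = orb and h = "\<lambda>_. 1 :: nat",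
        OF finite_good_sets finite_imageI[OF finite_good_sets] subset_refl] by simp
  also have "\<dots> = (\<Sum>C\<in>orb ` ?G. nat p)"
    by (intro sum.cong refl) (auto simp: orbit card_orb)
  finally show ?thesis by (simp add: n_p)
qed

section \<open>Expressing the counts by character sums\<close>

lemma sel_sign: "e = 1 \<or> e = -1 \<Longrightarrow> sel e x = 2 * of_bool (chi x = e)"
  using chi_cases[of x] by (auto simp: sel_def)

text \<open>The 64 is 2^6: each of the six factors \<open>sel\<close> is twice an indicator.\<close>

lemma card_embeddings_4:
  assumes "simple_graph4 E"
  shows "64 * int (card (embeddings {0..<4} E)) = (\<Sum>x\<in>R. \<Sum>y\<in>R. \<Sum>z\<in>R. \<Sum>u\<in>R.
      sel (edge_sign E 0 1) (x - y) * sel (edge_sign E 0 2) (x - z) * sel (edge_sign E 1 2) (y - z)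
      * sel (edge_sign E 0 3) (u - x) * sel (edge_sign E 1 3) (u - y) * sel (edge_sign E 2 3) (u - z))"
proof -
  define A where "A = {(x, y, z, u). x \<in> R \<and> y \<in> R \<and> z \<in> R \<and> u \<in> R \<and>
    chi (x - y) = edge_sign E 0 1 \<and> chi (x - z) = edge_sign E 0 2 \<and> chi (y - z) = edge_sign E 1 2 \<and>
    chi (u - x) = edge_sign E 0 3 \<and> chi (u - y) = edge_sign E 1 3 \<and> chi (u - z) = edge_sign E 2 3}"
  have V: "{0..<4} = {0, 1, 2, 3 :: nat}" by auto
  have es: "edge_sign E i j = edge_sign E j i" if "i \<in> {0..<4}" "j \<in> {0..<4}" for i j
    using assms that unfolding simple_graph4_def edge_sign_def by auto
  have es': "edge_sign E 1 0 = edge_sign E 0 1" "edge_sign E 2 0 = edge_sign E 0 2"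
    "edge_sign E 3 0 = edge_sign E 0 3" "edge_sign E 2 1 = edge_sign E 1 2"
    "edge_sign E 3 1 = edge_sign E 1 3" "edge_sign E 3 2 = edge_sign E 2 3"
    by (rule es; simp)+
  have emb: "f \<in> embeddings {0..<4} E \<longleftrightarrow> f \<in> {0..<4} \<rightarrow>\<^sub>E R \<and> (f 0, f 1, f 2, f 3) \<in> A" for f
  proof -
    have R: "f 0 \<in> R \<and> f 1 \<in> R \<and> f 2 \<in> R \<and> f 3 \<in> R" if "f \<in> {0..<4} \<rightarrow>\<^sub>E R"
      using that by (auto simp: PiE_def Pi_def)
    have "(\<forall>i\<in>{0..<4}. \<forall>j\<in>{0..<4}. i \<noteq> j \<longrightarrow> chi (f i - f j) = edge_sign E i j) \<longleftrightarrow>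
       chi (f 0 - f 1) = edge_sign E 0 1 \<and> chi (f 0 - f 2) = edge_sign E 0 2 \<and>
       chi (f 1 - f 2) = edge_sign E 1 2 \<and> chi (f 3 - f 0) = edge_sign E 0 3 \<and>
       chi (f 3 - f 1) = edge_sign E 1 3 \<and> chi (f 3 - f 2) = edge_sign E 2 3"
      unfolding V using es' chi_diff_commute[of "f 0"] chi_diff_commute[of "f 1" "f 2"]
        chi_diff_commute[of "f 1" "f 3"] chi_diff_commute[of "f 2" "f 3"] by auto
    with R show ?thesis unfolding embeddings_def A_def by blast
  qed
  have "bij_betw (\<lambda>f. (f 0, f 1, f 2, f 3)) (embeddings {0..<4} E) A"
  proof (rule bij_betw_byWitness[where f' = "\<lambda>(x, y, z, u). \<lambda>i\<in>{0..<4}. [x, y, z, u] ! i"])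
    show "\<forall>f\<in>embeddings {0..<4} E.
      (case (f 0, f 1, f 2, f 3) of (x, y, z, u) \<Rightarrow> \<lambda>i\<in>{0..<4}. [x, y, z, u] ! i) = f"
    proof
      fix f assume "f \<in> embeddings {0..<4} E"
      then have "f \<in> {0..<4} \<rightarrow>\<^sub>E R" unfolding embeddings_def by blast
      then have "(\<lambda>i\<in>{0..<4}. [f 0, f 1, f 2, f 3] ! i) = f"
        by (intro extensionalityI[of _ "{0..<4}"]) (auto simp: V PiE_def)
      then show "(case (f 0, f 1, f 2, f 3) of (x, y, z, u) \<Rightarrow> \<lambda>i\<in>{0..<4}. [x, y, z, u] ! i) = f"
        by simp
    qed
    show "\<forall>t\<in>A. (\<lambda>f. (f 0, f 1, f 2, f 3)) (case t of (x, y, z, u) \<Rightarrow> \<lambda>i\<in>{0..<4}. [x, y, z, u] ! i) = t"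
      by auto
    show "(\<lambda>f. (f 0, f 1, f 2, f 3)) ` embeddings {0..<4} E \<subseteq> A"
      using emb by auto
    show "(\<lambda>(x, y, z, u). \<lambda>i\<in>{0..<4}. [x, y, z, u] ! i) ` A \<subseteq> embeddings {0..<4} E"
    proof
      fix f assume "f \<in> (\<lambda>(x, y, z, u). \<lambda>i\<in>{0..<4}. [x, y, z, u] ! i) ` A"
      then obtain x y z u where t: "(x, y, z, u) \<in> A" and f: "f = (\<lambda>i\<in>{0..<4}. [x, y, z, u] ! i)"
        by auto
      have "f \<in> {0..<4} \<rightarrow>\<^sub>E R" using t unfolding f A_def V by auto
      moreover have "(f 0, f 1, f 2, f 3) = (x, y, z, u)" unfolding f by simp
      ultimately show "f \<in> embeddings {0..<4} E" using t emb by simp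
    qed
  qed
  then have "card (embeddings {0..<4} E) = card A" by (rule bij_betw_same_card)
  also have "int (card A) = (\<Sum>t\<in>R \<times> R \<times> R \<times> R. of_bool (t \<in> A))"
  proof -
    have "A = (R \<times> R \<times> R \<times> R) \<inter> A" unfolding A_def by auto
    then show ?thesis by (simp add: sum_of_bool_eq)
  qed
  also have "\<dots> = (\<Sum>x\<in>R. \<Sum>y\<in>R. \<Sum>z\<in>R. \<Sum>u\<in>R. of_bool ((x, y, z, u) \<in> A))"
    by (simp only: sum.cartesian_product')
  finally have "64 * int (card (embeddings {0..<4} E))
     = (\<Sum>x\<in>R. \<Sum>y\<in>R. \<Sum>z\<in>R. \<Sum>u\<in>R. 64 * of_bool ((x, y, z, u) \<in> A))"
    by (simp only: sum_distrib_left)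
  also have "\<dots> = (\<Sum>x\<in>R. \<Sum>y\<in>R. \<Sum>z\<in>R. \<Sum>u\<in>R.
      sel (edge_sign E 0 1) (x - y) * sel (edge_sign E 0 2) (x - z) * sel (edge_sign E 1 2) (y - z)
      * sel (edge_sign E 0 3) (u - x) * sel (edge_sign E 1 3) (u - y) * sel (edge_sign E 2 3) (u - z))"
  proof (intro sum.cong refl)
    fix x y z u assume xyzu: "x \<in> R" "y \<in> R" "z \<in> R" "u \<in> R"
    have sel: "sel (edge_sign E i j) t = 2 * of_bool (chi t = edge_sign E i j)" for i j t
      by (rule sel_sign) (simp add: edge_sign_def)
    show "64 * of_bool ((x, y, z, u) \<in> A) =
      sel (edge_sign E 0 1) (x - y) * sel (edge_sign E 0 2) (x - z) * sel (edge_sign E 1 2) (y - z)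
      * sel (edge_sign E 0 3) (u - x) * sel (edge_sign E 1 3) (u - y) * sel (edge_sign E 2 3) (u - z)"
      unfolding sel A_def using xyzu by (simp add: of_bool_conj)
  qed
  finally show ?thesis .
qed

lemma J_eq: assumes "p = 4 * int k + 1" shows "J k = J_sum"
proof -
  let ?f = "\<lambda>x. chi x * chi (x * x - 1)"
  have p: "int (4 * k + 1) = p" "int (4 * k) - 2 = p - 3" using assms by simp_all
  have "J k = (\<Sum>i\<in>{1..p - 3}. chi (i * (i + 1) * (i + 2)))"
    unfolding J_def p chi_def ..
  \<comment> \<open>The residues 0, p - 2 and p - 1 outside the range of \<open>J\<close> are
    exactly those where one of the three factors is divisible by \<open>p\<close>.\<close>
  also have "\<dots> = (\<Sum>i\<in>R. chi (i * (i + 1) * (i + 2)))"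
  proof (rule sum.mono_neutral_left)
    show "\<forall>i\<in>R - {1..p - 3}. chi (i * (i + 1) * (i + 2)) = 0"
    proof
      fix i assume "i \<in> R - {1..p - 3}"
      then have "i = 0 \<or> i + 1 = p \<or> i + 2 = p" by auto
      then have "p dvd i \<or> p dvd i + 1 \<or> p dvd i + 2" by auto
      then show "chi (i * (i + 1) * (i + 2)) = 0" unfolding chi_eq_0_iff dvd_mult_iff by blast
    qed
  qed auto
  \<comment> \<open>Centering at x = i + 1 gives x (x^2 - 1).\<close>
  also have "\<dots> = (\<Sum>i\<in>R. ?f (i + 1))"
    by (intro sum.cong refl) (simp add: chi_mult[symmetric] algebra_simps)
  also have "\<dots> = (\<Sum>i\<in>R. ?f i)"
    by (rule sum_shift[of ?f]) (auto intro!: arg_cong2[where f = "(*)"] chi_cong cong_mult cong_diff)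
  finally show ?thesis by (simp add: J_sum_def)
qed

end

section \<open>Explicit formulas for the number of classes\<close>

text \<open>Signs of the paths of length two (the products of the three sums) and of the 4-cycles; these
  two types of edge sets enter with the same coefficient.\<close>

definition path_sum :: "(nat \<Rightarrow> nat \<Rightarrow> bool) \<Rightarrow> int" where
  "path_sum E = (let s = edge_sign E; m = s 0 1 + s 2 3; n = s 0 2 + s 1 3; l = s 0 3 + s 1 2
     in m * n + m * l + n * l
       + s 0 2 * s 1 3 * s 1 2 * s 0 3 + s 0 1 * s 2 3 * s 1 2 * s 0 3 + s 0 1 * s 2 3 * s 0 2 * s 1 3)"

text \<open>Signs of the perfect matchings and of the paws, i.e. a triangle with a pendant edge.\<close>

definition paw_sum :: "(nat \<Rightarrow> nat \<Rightarrow> bool) \<Rightarrow> int" where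
  "paw_sum E = (let s = edge_sign E in s 0 1 * s 2 3 + s 0 2 * s 1 3 + s 1 2 * s 0 3
     + s 0 1 * s 0 2 * s 1 2 * (s 0 3 + s 1 3 + s 2 3) + s 0 1 * s 0 3 * s 1 3 * (s 0 2 + s 1 2 + s 2 3)
     + s 0 2 * s 0 3 * s 2 3 * (s 0 1 + s 1 2 + s 1 3) + s 1 2 * s 1 3 * s 2 3 * (s 0 1 + s 0 2 + s 0 3))"

definition edge_product :: "(nat \<Rightarrow> nat \<Rightarrow> bool) \<Rightarrow> int" where
  "edge_product E = (let s = edge_sign E in s 0 1 * s 0 2 * s 1 2 * s 0 3 * s 1 3 * s 2 3)"

text \<open>The factor \<open>p\<close> cancels against the orbit size, and p - 1 = 4 k reduces the
  64 to 16.\<close>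

lemma n_p_int:
  assumes "prime p" "p = 4 * k + 1" "simple_graph4 E"
  shows "16 * (int (card (automorphisms {0..<4} E)) * int (n_p p {0..<4} E)) =
    int k * ((4 * int k - 1) * (4 * int k - 2) - (4 * int k - 2) * path_sum E + 2 * paw_sum E
      + edge_product E * ((J k)\<^sup>2 - 8 * int k - 2))"
proof -
  interpret prime_1_mod_4 "int p"
  proof
    show "prime (int p)" using assms(1) by simp
    show "int p mod 4 = 1" using assms(2) by simp
  qed
  let ?a = "int (card (automorphisms {0..<4} E))" and ?n = "int (n_p p {0..<4} E)"
  let ?F = "(int p - 2) * (int p - 3) - (int p - 3) * path_sum E + 2 * paw_sum E + edge_product E * K4_sum"
  have nd: "\<not> int p dvd int (card {0..<4::nat})" using not_dvd_4 by simp
  have irr: "\<forall>x\<in>{0..<4}. \<not> E x x" using assms(3) unfolding simple_graph4_def by blast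
  have "64 * int (card (embeddings {0..<4} E)) = int p * (int p - 1) * ?F"
    unfolding card_embeddings_4[OF assms(3)] sum_pattern path_sum_def paw_sum_def edge_product_def Let_def
    by (simp add: algebra_simps)
  also have "int (card (embeddings {0..<4} E)) = ?n * int p * ?a"
    using card_embeddings[of "{0..<4}" E] card_good_sets[OF nd, of E] irr by simp
  finally have "int p * (64 * (?a * ?n)) = int p * ((int p - 1) * ?F)" by (simp only: mult_ac)
  then have "64 * (?a * ?n) = (int p - 1) * ?F" using p_gt_4 by simp
  then have "4 * (16 * (?a * ?n)) = 4 * (int k * ?F)" using assms(2) by simp
  then have "16 * (?a * ?n) = int k * ?F" by linarith
  moreover have p: "int p = 4 * int k + 1" using assms(2) by simp
  have "K4_sum = (J k)\<^sup>2 - 2 * int p" using K4_sum_eq J_eq[OF p] by simp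
  then have "?F = (4 * int k - 1) * (4 * int k - 2) - (4 * int k - 2) * path_sum E + 2 * paw_sum E
      + edge_product E * ((J k)\<^sup>2 - 8 * int k - 2)"
    using p by (simp only:) (simp add: algebra_simps)
  ultimately show ?thesis by (simp only:)
qed

text \<open>Substituting J^2 = 32 d + 4 and cancelling 2 leaves a cubic in \<open>k\<close> plus a
  multiple of k d.\<close>

lemma n_p_rat:
  assumes "prime p" "p = 4 * k + 1" "simple_graph4 E"
  shows "of_nat (n_p p {0..<4} E) =
    (of_int (1 + path_sum E + paw_sum E + edge_product E) * of_nat k
    - of_int (6 + 2 * path_sum E + 4 * edge_product E) * of_nat k ^ 2 + 8 * of_nat k ^ 3
    + of_int (16 * edge_product E) * of_nat k * d k) / (8 * of_nat (card (automorphisms {0..<4} E)))"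
proof -
  let ?a = "of_nat (card (automorphisms {0..<4} E)) :: rat"
  have a: "?a \<noteq> 0" using card_automorphisms_pos[of "{0..<4}" E] by simp
  have J: "(of_int (J k))\<^sup>2 = 32 * d k + 4" by (simp add: d_def field_simps)
  have "16 * (?a * of_nat (n_p p {0..<4} E)) = of_nat k * ((4 * of_nat k - 1) * (4 * of_nat k - 2)
      - (4 * of_nat k - 2) * of_int (path_sum E) + 2 * of_int (paw_sum E)
      + of_int (edge_product E) * ((of_int (J k))\<^sup>2 - 8 * of_nat k - 2))"
    using arg_cong[OF n_p_int[OF assms], of "of_int :: int \<Rightarrow> rat"] by simp
  then have "of_nat (n_p p {0..<4} E) * (8 * ?a)
    = of_int (1 + path_sum E + paw_sum E + edge_product E) * of_nat k
    - of_int (6 + 2 * path_sum E + 4 * edge_product E) * of_nat k ^ 2 + 8 * of_nat k ^ 3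
    + of_int (16 * edge_product E) * of_nat k * d k"
    unfolding J by (simp add: algebra_simps power2_eq_square power3_eq_cube)
  then show ?thesis using a by (simp add: eq_divide_eq)
qed

theorem theorem3p1:
  shows "(\<forall>E. simple_graph4 E \<longrightarrow>
            (\<exists>(N::nat) (c::nat \<Rightarrow> nat \<Rightarrow> rat). \<forall>p k::nat. prime p \<and> p = 4*k+1 \<longrightarrow>
               of_nat (n_p p {0..<4} E) =
                 (\<Sum>i\<le>N. \<Sum>j\<le>N. c i j * of_nat k ^ i * d k ^ j)))
       \<and> (\<forall>p k::nat. prime p \<and> p = 4*k+1 \<longrightarrow>
            of_nat (n_p p {0..<4} (\<lambda>x y. x \<noteq> y)) =
              (of_nat k * (of_nat k - 1) * (of_nat k - 4) + 2 * of_nat k * d k) / (24::rat))"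
proof (intro conjI allI impI)
  fix E assume E: "simple_graph4 E"
  let ?a = "of_nat (card (automorphisms {0..<4} E)) :: rat"
  define q r s :: rat where q: "q = of_int (1 + path_sum E + paw_sum E + edge_product E)"
    and r: "r = of_int (6 + 2 * path_sum E + 4 * edge_product E)" and s: "s = of_int (16 * edge_product E)"
  \<comment> \<open>Only the monomials k, k^2, k^3 and k d occur, so the bound 3 on both exponents
    suffices.\<close>
  define c :: "nat \<Rightarrow> nat \<Rightarrow> rat" where "c i j =
    (if (i, j) = (1, 0) then q else if (i, j) = (2, 0) then - r else if (i, j) = (3, 0) then 8
     else if (i, j) = (1, 1) then s else 0) / (8 * ?a)" for i j
  have "(\<Sum>i\<le>3. \<Sum>j\<le>3. c i j * x ^ i * y ^ j) =
    (q * x - r * x ^ 2 + 8 * x ^ 3 + s * x * y) / (8 * ?a)" for x y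
    by (simp add: c_def numeral_eq_Suc add_divide_distrib diff_divide_distrib)
  then have "\<forall>p k. prime p \<and> p = 4 * k + 1 \<longrightarrow>
      of_nat (n_p p {0..<4} E) = (\<Sum>i\<le>3. \<Sum>j\<le>3. c i j * of_nat k ^ i * d k ^ j)"
    using n_p_rat[OF _ _ E] unfolding q r s by simp
  then show "\<exists>N c. \<forall>p k. prime p \<and> p = 4 * k + 1 \<longrightarrow>
      of_nat (n_p p {0..<4} E) = (\<Sum>i\<le>N. \<Sum>j\<le>N. c i j * of_nat k ^ i * d k ^ j)"
    by blast
next
  fix p k :: nat assume p: "prime p \<and> p = 4 * k + 1"
  have K4: "simple_graph4 (\<lambda>x y. x \<noteq> y)" unfolding simple_graph4_def by auto
  show "of_nat (n_p p {0..<4} (\<lambda>x y. x \<noteq> y)) =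
      (of_nat k * (of_nat k - 1) * (of_nat k - 4) + 2 * of_nat k * d k) / (24::rat)"
    \<comment> \<open>All signs are 1, so \<open>path_sum\<close> and \<open>paw_sum\<close> are 15
      and \<open>edge_product\<close> is 1; the quotient is 8 (k^3 - 5 k^2 + 4 k + 2 k d) / (8 *
      24).\<close>
    using n_p_rat[OF conjunct1[OF p] conjunct2[OF p] K4]
    by (simp add: card_automorphisms_K4 path_sum_def paw_sum_def edge_product_def edge_sign_def
        field_simps power2_eq_square power3_eq_cube)
qed

end
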